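(* Let $B$ be a supersoluble brace. Then $B$ has a chain of ideals $$\{0\}=I_{0,0}\le I_{0,1}\le\dots\le I_{0,\ell}=I_{1,0}\le I_{1,1}\le\dots\le I_{1,m}=I_{2,0}\le I_{2,1}\le\dots\le I_{2,n}=B$$ such that: $|I_{0,i+1}/I_{0,i}|$ is an odd prime for all $0\le i<\ell$; $|I_{0,i+1}/I_{0,i}|\ge|I_{0,i+2}/I_{0,i+1}|$ for all $0\le i<\ell-1$; $I_{1,i+1}/I_{1,i}\le\operatorname{Soc}(B/I_{1,i})$ and $(I_{1,i+1}/I_{1,i},+)$ is infinite cyclic for all $0\le i<m$; and $|I_{2,i+1}/I_{2,i}|=2$ for all $0\le i<n$.
   Context: A brace (skew left brace) is a set $B$ with two binary operations $+$ and $\cdot$ such that $(B,+)$ and $(B,\cdot)$ are groups and $a(b+c)=ab-a+ac$ for all $a,b,c\in B$. For $a,b\in B$ put $\lambda_a(b)=-a+ab$; $\lambda\colon(B,\cdot)\to\operatorname{Aut}(B,+)$ is a homomorphism. An ideal of $B$ is a subset that is a subgroup of both groups, normal in $(B,+)$ and in $(B,\cdot)$, and invariant under all $\lambda_b$ ($b\in B$); quotients $B/I$ by ideals are braces. $\operatorname{Soc}(B)=\operatorname{Ker}\lambda\cap Z(B,+)$. A brace $B$ is supersoluble if there is a finite chain of ideals $\{0\}=I_0\le\dots\le I_n=B$ such that for each $i$, either $(I_{i+1}/I_i,+)$ is infinite cyclic and $I_{i+1}/I_i\le\operatorname{Soc}(B/I_i)$, or $I_{i+1}/I_i$ has prime order.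 *)

theory Defs
  imports "HOL-Algebra.Algebra" "HOL-Computational_Algebra.Primes"
begin

record 'a brace =
  bcar :: "'a set"
  badd :: "'a \<Rightarrow> 'a \<Rightarrow> 'a"
  bmul :: "'a \<Rightarrow> 'a \<Rightarrow> 'a"

definition addG :: "('a, 'b) brace_scheme \<Rightarrow> 'a monoid" where
  "addG B = \<lparr>carrier = bcar B, monoid.mult = badd B,
     monoid.one = (THE e. e \<in> bcar B \<and> (\<forall>x\<in>bcar B. badd B e x = x \<and> badd B x e = x))\<rparr>"

definition mulG :: "('a, 'b) brace_scheme \<Rightarrow> 'a monoid" where
  "mulG B = \<lparr>carrier = bcar B, monoid.mult = bmul B,
     monoid.one = (THE e. e \<in> bcar B \<and> (\<forall>x\<in>bcar B. bmul B e x = x \<and> bmul B x e = x))\<rparr>"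

definition bzero :: "('a, 'b) brace_scheme \<Rightarrow> 'a" where
  "bzero B = \<one>\<^bsub>addG B\<^esub>"

definition bneg :: "('a, 'b) brace_scheme \<Rightarrow> 'a \<Rightarrow> 'a" where
  "bneg B a = inv\<^bsub>addG B\<^esub> a"

definition is_brace :: "('a, 'b) brace_scheme \<Rightarrow> bool" where
  "is_brace B \<longleftrightarrow> group (addG B) \<and> group (mulG B) \<and>
     (\<forall>a\<in>bcar B. \<forall>b\<in>bcar B. \<forall>c\<in>bcar B.
        bmul B a (badd B b c) = badd B (badd B (bmul B a b) (bneg B a)) (bmul B a c))"

definition blam :: "('a, 'b) brace_scheme \<Rightarrow> 'a \<Rightarrow> 'a \<Rightarrow> 'a" where
  "blam B a b = badd B (bneg B a) (bmul B a b)"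

definition is_ideal :: "('a, 'b) brace_scheme \<Rightarrow> 'a set \<Rightarrow> bool" where
  "is_ideal B I \<longleftrightarrow> subgroup I (addG B) \<and> subgroup I (mulG B) \<and>
     I \<lhd> addG B \<and> I \<lhd> mulG B \<and> (\<forall>b\<in>bcar B. \<forall>x\<in>I. blam B b x \<in> I)"

text \<open>Quotient brace B/I: additive cosets of I with the induced operations
  (for an ideal I, the additive and multiplicative cosets coincide).\<close>
definition bquot :: "('a, 'b) brace_scheme \<Rightarrow> 'a set \<Rightarrow> 'a set brace" where
  "bquot B I = \<lparr>bcar = rcosets\<^bsub>addG B\<^esub> I,
                badd = set_mult (addG B), bmul = set_mult (mulG B)\<rparr>"

definition subquot :: "('a, 'b) brace_scheme \<Rightarrow> 'a set \<Rightarrow> 'a set \<Rightarrow> 'a set set" where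
  "subquot B J I = (\<lambda>a. I #>\<^bsub>addG B\<^esub> a) ` J"

definition bsoc :: "('a, 'b) brace_scheme \<Rightarrow> 'a set" where
  "bsoc B = {a \<in> bcar B. (\<forall>b\<in>bcar B. blam B a b = b) \<and>
                          (\<forall>b\<in>bcar B. badd B a b = badd B b a)}"

definition infinite_cyclic_group :: "('a, 'b) monoid_scheme \<Rightarrow> bool" where
  "infinite_cyclic_group G \<longleftrightarrow> group G \<and> infinite (carrier G) \<and>
     (\<exists>g\<in>carrier G. carrier G = {g [^]\<^bsub>G\<^esub> (k::int) | k. True})"

definition subquot_addG :: "('a, 'b) brace_scheme \<Rightarrow> 'a set \<Rightarrow> 'a set \<Rightarrow> 'a set monoid" where
  "subquot_addG B J I = (addG (bquot B I))\<lparr>carrier := subquot B J I\<rparr>"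

definition soc_cyclic_step :: "('a, 'b) brace_scheme \<Rightarrow> 'a set \<Rightarrow> 'a set \<Rightarrow> bool" where
  "soc_cyclic_step B I J \<longleftrightarrow> infinite_cyclic_group (subquot_addG B J I) \<and>
      subquot B J I \<subseteq> bsoc (bquot B I)"

definition supersoluble :: "('a, 'b) brace_scheme \<Rightarrow> bool" where
  "supersoluble B \<longleftrightarrow> (\<exists>(n::nat) (I :: nat \<Rightarrow> 'a set).
      I 0 = {bzero B} \<and> I n = bcar B \<and> (\<forall>i\<le>n. is_ideal B (I i)) \<and>
      (\<forall>i<n. I i \<subseteq> I (Suc i) \<and>
         (soc_cyclic_step B (I i) (I (Suc i)) \<or> Factorial_Ring.prime (card (subquot B (I (Suc i)) (I i))))))"

end

theory Submission
  imports Defs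
begin

text \<open>Adjacent factors of a chain of ideals can be rearranged: \<open>(p, q)\<close> with \<open>p < q\<close> becomes \<open>(q, p)\<close>
  since the Sylow \<open>q\<close>-subgroup is unique for both operations; an infinite cyclic factor in the socle
  followed by an odd prime \<open>p\<close> either merges into one infinite cyclic factor in the socle or becomes
  \<open>(p, \<infinity>)\<close>; and \<open>(2, \<infinity>)\<close> becomes \<open>(\<infinity>, 2, 2)\<close>. Inserting the factors of a given chain one by one and
  moving each to its place with these rules sorts the chain.\<close>

section \<open>Braces\<close>

text \<open>Every exchange is proved only over the zero ideal and then pulled back from a quotient.
  For this, \<open>soc_step\<close> states the socle condition by elements and membership instead of
  cosets. What shapes the proof is a sign: \<lambda> acts on an infinite cyclic ideal by 1 or -1. An
  element with an odd power acting trivially cannot act by -1, so an odd prime can move below an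
  infinite cyclic factor or merge with it. For 2 this argument fails, and factors of order 2 have to
  go to the top. If an infinite cyclic factor generated by x lies above a factor of order 2, then x
  is in the socle only up to errors of order 2; they cancel for 2x, and passing from x to 2x costs
  the additional factor 2. Merging removes a factor and this doubling adds one, so the number of
  factors is not preserved. The sorting therefore runs by structural induction on inductively
  defined sorted chains and not by counting inversions.\<close>

lemma addG_sel [simp]: "carrier (addG B) = bcar B" "monoid.mult (addG B) = badd B"
  by (simp_all add: addG_def)

lemma mulG_sel [simp]: "carrier (mulG B) = bcar B" "monoid.mult (mulG B) = bmul B"
  by (simp_all add: mulG_def)

lemma is_idealD:
  assumes "is_ideal B I"
  shows "subgroup I (addG B)" "subgroup I (mulG B)" "I \<lhd> addG B" "I \<lhd> mulG B" "I \<subseteq> bcar B"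
  using assms subgroup.subset[of I "addG B"] unfolding is_ideal_def by auto

locale skew_brace =
  fixes B :: "('a, 'b) brace_scheme"
  assumes brace: "is_brace B"
begin

sublocale A: group "addG B"
  using brace by (simp add: is_brace_def)

sublocale M: group "mulG B"
  using brace by (simp add: is_brace_def)

abbreviation plus_B (infixl "\<boxplus>" 65) where "plus_B \<equiv> badd B"
abbreviation times_B (infixl "\<boxdot>" 70) where "times_B \<equiv> bmul B"
abbreviation neg ("\<boxminus> _" [81] 80) where "neg \<equiv> bneg B"
abbreviation zero_B ("\<zero>\<^sub>B") where "\<zero>\<^sub>B \<equiv> bzero B"
abbreviation lam ("\<lambda>\<^sub>B") where "lam \<equiv> blam B"
abbreviation minv where "minv a \<equiv> inv\<^bsub>mulG B\<^esub> a"
abbreviation smul (infixr "\<star>" 75) where "smul (k::int) a \<equiv> a [^]\<^bsub>addG B\<^esub> k"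
abbreviation mpow (infixr "\<up>" 80) where "mpow a (n::nat) \<equiv> a [^]\<^bsub>mulG B\<^esub> n"

section \<open>The additive group in brace notation\<close>

lemmas addG_fold = addG_sel bzero_def[symmetric] bneg_def[symmetric]

lemmas add_closed [simp, intro] = A.m_closed[unfolded addG_fold]
lemmas add_assoc = A.m_assoc[unfolded addG_fold]
lemmas zero_closed [simp, intro] = A.one_closed[unfolded addG_fold]
lemmas neg_closed [simp, intro] = A.inv_closed[unfolded addG_fold]
lemmas zero_add [simp] = A.l_one[unfolded addG_fold]
lemmas add_zero [simp] = A.r_one[unfolded addG_fold]
lemmas neg_add [simp] = A.l_inv[unfolded addG_fold]
lemmas add_neg [simp] = A.r_inv[unfolded addG_fold]
lemmas neg_neg [simp] = A.inv_inv[unfolded addG_fold]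
lemmas neg_zero [simp] = A.inv_one[unfolded addG_fold]
lemmas neg_sum = A.inv_mult_group[unfolded addG_fold]

lemma add_left_cancel [simp]: "c \<in> bcar B \<Longrightarrow> a \<in> bcar B \<Longrightarrow> b \<in> bcar B \<Longrightarrow> c \<boxplus> a = c \<boxplus> b \<longleftrightarrow> a = b"
  using A.l_cancel by auto

lemma add_right_cancel [simp]: "c \<in> bcar B \<Longrightarrow> a \<in> bcar B \<Longrightarrow> b \<in> bcar B \<Longrightarrow> a \<boxplus> c = b \<boxplus> c \<longleftrightarrow> a = b"
  using A.r_cancel by auto

lemmas neg_equality = A.inv_equality[unfolded addG_fold]

lemma neg_add_cancel [simp]: "a \<in> bcar B \<Longrightarrow> b \<in> bcar B \<Longrightarrow> \<boxminus> a \<boxplus> (a \<boxplus> b) = b"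
  by (simp add: add_assoc[symmetric])

lemma add_neg_cancel [simp]: "a \<in> bcar B \<Longrightarrow> b \<in> bcar B \<Longrightarrow> a \<boxplus> (\<boxminus> a \<boxplus> b) = b"
  by (simp add: add_assoc[symmetric])

lemma diff_eq_zero_iff: "a \<in> bcar B \<Longrightarrow> b \<in> bcar B \<Longrightarrow> a \<boxplus> \<boxminus> b = \<zero>\<^sub>B \<longleftrightarrow> a = b"
  by (metis neg_equality neg_closed neg_neg add_neg)

lemmas smul_closed [simp, intro] = A.int_pow_closed[unfolded addG_fold]
lemmas smul_zero_left [simp] = int_pow_0[of "addG B", unfolded addG_fold]
lemmas smul_one_left [simp] = A.int_pow_1[unfolded addG_fold]
lemmas smul_zero_right [simp] = A.int_pow_one[unfolded addG_fold]
lemmas smul_add_left = A.int_pow_mult[unfolded addG_fold]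
lemmas smul_neg_left = A.int_pow_neg[unfolded addG_fold]
lemmas smul_smul = A.int_pow_pow[unfolded addG_fold]
lemmas smul_diff_left = A.int_pow_diff[unfolded addG_fold]
lemmas smul_add_right = A.int_pow_mult_distrib[unfolded addG_fold]

lemma smul_two: "a \<in> bcar B \<Longrightarrow> 2 \<star> a = a \<boxplus> a"
proof -
  assume a: "a \<in> bcar B"
  have "(1 + 1 :: int) \<star> a = 1 \<star> a \<boxplus> 1 \<star> a" by (rule smul_add_left[OF a])
  then show ?thesis unfolding smul_one_left[OF a] one_add_one .
qed

section \<open>The multiplicative group and its common identity with the additive one\<close>

lemmas mul_closed [simp, intro] = M.m_closed[unfolded mulG_sel]
lemmas mul_assoc = M.m_assoc[unfolded mulG_sel]
lemmas minv_closed [simp, intro] = M.inv_closed[unfolded mulG_sel]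
lemmas mpow_closed [simp, intro] = M.nat_pow_closed[unfolded mulG_sel]

lemma distrib:
  "a \<in> bcar B \<Longrightarrow> b \<in> bcar B \<Longrightarrow> c \<in> bcar B \<Longrightarrow> a \<boxdot> (b \<boxplus> c) = a \<boxdot> b \<boxplus> \<boxminus> a \<boxplus> a \<boxdot> c"
  using brace by (simp add: is_brace_def)

text \<open>Expanding a(0 + 0) by \<open>distrib\<close> and cancelling a0 leaves 0 = -a +
  a0.\<close>

lemma mul_zero [simp]: "a \<in> bcar B \<Longrightarrow> a \<boxdot> \<zero>\<^sub>B = a"
proof -
  assume a: "a \<in> bcar B"
  have "a \<boxdot> \<zero>\<^sub>B \<boxplus> \<zero>\<^sub>B = a \<boxdot> \<zero>\<^sub>B \<boxplus> (\<boxminus> a \<boxplus> a \<boxdot> \<zero>\<^sub>B)"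
    using distrib[of a "\<zero>\<^sub>B" "\<zero>\<^sub>B"] a by (simp add: add_assoc)
  then have "\<zero>\<^sub>B = \<boxminus> a \<boxplus> a \<boxdot> \<zero>\<^sub>B"
    using a by (subst (asm) add_left_cancel) auto
  then have "a \<boxplus> \<zero>\<^sub>B = a \<boxplus> (\<boxminus> a \<boxplus> a \<boxdot> \<zero>\<^sub>B)"
    by simp
  then show ?thesis using a by simp
qed

text \<open>The product of the multiplicative identity with zero is evaluated twice, by the group
  law and by \<open>mul_zero\<close>.\<close>

lemma mul_one_eq: "\<one>\<^bsub>mulG B\<^esub> = \<zero>\<^sub>B"
  using M.l_one[of "\<zero>\<^sub>B"] mul_zero[of "\<one>\<^bsub>mulG B\<^esub>"] M.one_closed by simp

lemmas zero_mul [simp] = M.l_one[unfolded mulG_sel mul_one_eq]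
lemmas minv_mul [simp] = M.l_inv[unfolded mulG_sel mul_one_eq]
lemmas mul_minv [simp] = M.r_inv[unfolded mulG_sel mul_one_eq]
lemmas minv_minv [simp] = M.inv_inv[unfolded mulG_sel]

lemma mul_left_cancel [simp]: "c \<in> bcar B \<Longrightarrow> a \<in> bcar B \<Longrightarrow> b \<in> bcar B \<Longrightarrow> c \<boxdot> a = c \<boxdot> b \<longleftrightarrow> a = b"
  using M.l_cancel by auto

lemma mul_right_cancel [simp]: "c \<in> bcar B \<Longrightarrow> a \<in> bcar B \<Longrightarrow> b \<in> bcar B \<Longrightarrow> a \<boxdot> c = b \<boxdot> c \<longleftrightarrow> a = b"
  using M.r_cancel by auto

lemmas mpow_0 [simp] = nat_pow_0[of "mulG B", unfolded mul_one_eq]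
lemmas mpow_Suc [simp] = nat_pow_Suc[of "mulG B", unfolded mulG_sel]

lemma minv_mul_cancel [simp]: "a \<in> bcar B \<Longrightarrow> b \<in> bcar B \<Longrightarrow> minv a \<boxdot> (a \<boxdot> b) = b"
  by (simp add: mul_assoc[symmetric])

lemma mul_minv_cancel [simp]: "a \<in> bcar B \<Longrightarrow> b \<in> bcar B \<Longrightarrow> a \<boxdot> (minv a \<boxdot> b) = b"
  by (simp add: mul_assoc[symmetric])

section \<open>The action \<lambda>\<close>

lemma lam_closed [simp, intro]: "a \<in> bcar B \<Longrightarrow> b \<in> bcar B \<Longrightarrow> \<lambda>\<^sub>B a b \<in> bcar B"
  by (simp add: blam_def)

lemma mul_eq: "a \<in> bcar B \<Longrightarrow> b \<in> bcar B \<Longrightarrow> a \<boxdot> b = a \<boxplus> \<lambda>\<^sub>B a b"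
  by (simp add: blam_def)

lemma lam_add: "a \<in> bcar B \<Longrightarrow> b \<in> bcar B \<Longrightarrow> c \<in> bcar B \<Longrightarrow> \<lambda>\<^sub>B a (b \<boxplus> c) = \<lambda>\<^sub>B a b \<boxplus> \<lambda>\<^sub>B a c"
  by (simp add: blam_def distrib add_assoc)

lemma lam_zero [simp]: "a \<in> bcar B \<Longrightarrow> \<lambda>\<^sub>B a \<zero>\<^sub>B = \<zero>\<^sub>B"
  by (simp add: blam_def)

lemma lam_neg: "a \<in> bcar B \<Longrightarrow> b \<in> bcar B \<Longrightarrow> \<lambda>\<^sub>B a (\<boxminus> b) = \<boxminus> (\<lambda>\<^sub>B a b)"
  using lam_add[of a "\<boxminus> b" b] neg_equality[of "\<lambda>\<^sub>B a (\<boxminus> b)" "\<lambda>\<^sub>B a b"] by simp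

lemma lam_zero_left [simp]: "b \<in> bcar B \<Longrightarrow> \<lambda>\<^sub>B \<zero>\<^sub>B b = b"
  by (simp add: blam_def)

text \<open>Substituting -b + bc for \<lambda>_b(c) and using additivity of \<lambda>_a reduces both
  sides to -ab + abc.\<close>

lemma lam_mul:
  assumes "a \<in> bcar B" "b \<in> bcar B" "c \<in> bcar B"
  shows "\<lambda>\<^sub>B (a \<boxdot> b) c = \<lambda>\<^sub>B a (\<lambda>\<^sub>B b c)"
proof -
  have "\<lambda>\<^sub>B a (\<lambda>\<^sub>B b c) = \<lambda>\<^sub>B a (\<boxminus> b) \<boxplus> \<lambda>\<^sub>B a (b \<boxdot> c)"
    using assms lam_add[of a "\<boxminus> b" "b \<boxdot> c"] by (simp add: blam_def[of B b c])
  also have "\<dots> = \<lambda>\<^sub>B (a \<boxdot> b) c"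
    using assms by (simp add: lam_neg) (simp add: blam_def neg_sum add_assoc mul_assoc)
  finally show ?thesis ..
qed

lemma lam_minv_cancel [simp]: "a \<in> bcar B \<Longrightarrow> b \<in> bcar B \<Longrightarrow> \<lambda>\<^sub>B (minv a) (\<lambda>\<^sub>B a b) = b"
  and lam_cancel_minv [simp]: "a \<in> bcar B \<Longrightarrow> b \<in> bcar B \<Longrightarrow> \<lambda>\<^sub>B a (\<lambda>\<^sub>B (minv a) b) = b"
  by (simp_all add: lam_mul[symmetric])

lemma lam_eq_zero_iff [simp]: "a \<in> bcar B \<Longrightarrow> b \<in> bcar B \<Longrightarrow> \<lambda>\<^sub>B a b = \<zero>\<^sub>B \<longleftrightarrow> b = \<zero>\<^sub>B"
  by (metis lam_minv_cancel lam_zero minv_closed)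

lemma lam_hom: "a \<in> bcar B \<Longrightarrow> \<lambda>\<^sub>B a \<in> hom (addG B) (addG B)"
  by (auto simp: hom_def lam_add)

lemma lam_smul: "a \<in> bcar B \<Longrightarrow> b \<in> bcar B \<Longrightarrow> \<lambda>\<^sub>B a (k \<star> b) = k \<star> \<lambda>\<^sub>B a b"
  using hom_int_pow[OF lam_hom, of a b k] A.group_axioms by simp

text \<open>By \<open>mul_eq\<close>, the product of \<open>minv a\<close> and \<open>a\<close> is
  the sum of \<open>minv a\<close> and \<open>\<lambda>\<^sub>B (minv a) a\<close>, and it is
  zero.\<close>

lemma minv_eq: "a \<in> bcar B \<Longrightarrow> minv a = \<boxminus> (\<lambda>\<^sub>B (minv a) a)"
  using mul_eq[of "minv a" a] neg_equality[of "minv a" "\<lambda>\<^sub>B (minv a) a"] by simp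

lemma subgroup_addI:
  assumes "L \<subseteq> bcar B" "\<zero>\<^sub>B \<in> L" "\<And>a b. a \<in> L \<Longrightarrow> b \<in> L \<Longrightarrow> a \<boxplus> b \<in> L" "\<And>a. a \<in> L \<Longrightarrow> \<boxminus> a \<in> L"
  shows "subgroup L (addG B)"
  using assms by (intro subgroup.intro) (auto simp: bneg_def bzero_def)

lemma subgroup_addD:
  assumes "subgroup L (addG B)"
  shows "L \<subseteq> bcar B" "\<zero>\<^sub>B \<in> L" "\<And>a b. a \<in> L \<Longrightarrow> b \<in> L \<Longrightarrow> a \<boxplus> b \<in> L" "\<And>a. a \<in> L \<Longrightarrow> \<boxminus> a \<in> L"
    "\<And>a (k::int). a \<in> L \<Longrightarrow> k \<star> a \<in> L"
proof -
  show *: "L \<subseteq> bcar B" "\<zero>\<^sub>B \<in> L" "\<And>a b. a \<in> L \<Longrightarrow> b \<in> L \<Longrightarrow> a \<boxplus> b \<in> L" "\<And>a. a \<in> L \<Longrightarrow> \<boxminus> a \<in> L"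
    using subgroup.subset[OF assms] subgroup.one_closed[OF assms] subgroup.m_closed[OF assms]
      subgroup.m_inv_closed[OF assms] by (auto simp: bneg_def bzero_def)
  show "k \<star> a \<in> L" if "a \<in> L" for a and k :: int
    using A.int_pow_consistent[OF assms that, of k] that
      group.int_pow_closed[OF A.subgroup_imp_group[OF assms], of a k] by simp
qed

text \<open>Products and inverses are sums and negatives up to \<lambda>, by \<open>mul_eq\<close>
  and \<open>minv_eq\<close>, so invariance under \<lambda> turns additive closure into
  multiplicative closure.\<close>

lemma left_ideal_subgroup_mulG:
  assumes "subgroup L (addG B)" and "\<And>b x. b \<in> bcar B \<Longrightarrow> x \<in> L \<Longrightarrow> \<lambda>\<^sub>B b x \<in> L"
  shows "subgroup L (mulG B)"
proof (rule subgroup.intro)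
  note L = subgroup_addD[OF assms(1)]
  show "minv x \<in> L" if "x \<in> L" for x
  proof -
    have x: "x \<in> bcar B" using L(1) that by blast
    show ?thesis
      using L(4)[OF assms(2)[OF minv_closed[OF x] that]] minv_eq[OF x] by argo
  qed
qed (use subgroup_addD[OF assms(1)] assms(2) in \<open>auto simp: mul_one_eq mul_eq subset_iff\<close>)

lemma idealI:
  assumes "subgroup L (addG B)"
    and "\<And>b x. b \<in> bcar B \<Longrightarrow> x \<in> L \<Longrightarrow> \<lambda>\<^sub>B b x \<in> L"
    and "\<And>b x. b \<in> bcar B \<Longrightarrow> x \<in> L \<Longrightarrow> b \<boxplus> x \<boxplus> \<boxminus> b \<in> L"
    and "\<And>b x. b \<in> bcar B \<Longrightarrow> x \<in> L \<Longrightarrow> b \<boxdot> x \<boxdot> minv b \<in> L"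
  shows "is_ideal B L"
  using assms left_ideal_subgroup_mulG[OF assms(1,2)]
  by (auto simp: is_ideal_def A.normal_inv_iff M.normal_inv_iff bneg_def)

lemma idealD:
  assumes "is_ideal B L"
  shows "\<And>b x. b \<in> bcar B \<Longrightarrow> x \<in> L \<Longrightarrow> \<lambda>\<^sub>B b x \<in> L"
    "\<And>b x. b \<in> bcar B \<Longrightarrow> x \<in> L \<Longrightarrow> b \<boxplus> x \<boxplus> \<boxminus> b \<in> L"
    "\<And>b x. b \<in> bcar B \<Longrightarrow> x \<in> L \<Longrightarrow> b \<boxdot> x \<boxdot> minv b \<in> L"
    "\<And>a b. a \<in> L \<Longrightarrow> b \<in> L \<Longrightarrow> a \<boxdot> b \<in> L"
    "\<And>a. a \<in> L \<Longrightarrow> minv a \<in> L"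
  using assms subgroup.m_closed[of L "mulG B"] subgroup.m_inv_closed[of L "mulG B"]
  by (auto simp: is_ideal_def A.normal_inv_iff M.normal_inv_iff bneg_def)

lemmas ideal_add = subgroup_addD[OF is_idealD(1)]

lemma zero_ideal: "is_ideal B {\<zero>\<^sub>B}"
  by (intro idealI subgroup_addI) auto

end

section \<open>Homomorphisms and quotients\<close>

text \<open>This is \<open>soc_cyclic_step\<close> written with representatives: x generates J
  modulo I, no nonzero multiple of x is in I, and I contains \<lambda>_a(b) - b and the additive
  commutator of a and b. In this form the condition transfers along preimages;
  \<open>soc_cyclic_step_iff\<close> links it to the original one.\<close>

definition soc_step :: "('a, 'b) brace_scheme \<Rightarrow> 'a set \<Rightarrow> 'a set \<Rightarrow> bool" where
  "soc_step B I J \<longleftrightarrow>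
     (\<exists>x\<in>J. (\<forall>a\<in>J. \<exists>k::int. badd B a (bneg B (x [^]\<^bsub>addG B\<^esub> k)) \<in> I) \<and>
            (\<forall>k::int. x [^]\<^bsub>addG B\<^esub> k \<in> I \<longrightarrow> k = 0)) \<and>
     (\<forall>a\<in>J. \<forall>b\<in>bcar B. badd B (blam B a b) (bneg B b) \<in> I \<and>
                          badd B (badd B a b) (bneg B (badd B b a)) \<in> I)"

text \<open>A generator of finite order would leave only finitely many powers; conversely, without
  torsion the powers with different integer exponents are distinct.\<close>

lemma (in group) infinite_cyclic_group_iff:
  assumes "subgroup H G"
  shows "infinite_cyclic_group (G\<lparr>carrier := H\<rparr>) \<longleftrightarrow>
    (\<exists>x\<in>H. (\<forall>a\<in>H. \<exists>k::int. a = x [^] k) \<and> (\<forall>k::int. x [^] k = \<one> \<longrightarrow> k = 0))" (is "?L \<longleftrightarrow> ?R")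
proof -
  let ?H = "G\<lparr>carrier := H\<rparr>"
  have grp: "group ?H" using subgroup_imp_group[OF assms] .
  note pow = int_pow_consistent[OF assms, symmetric]
  have sub: "H \<subseteq> carrier G" using subgroup.subset[OF assms] .
  have pow_in: "x [^] (k::int) \<in> H" if "x \<in> H" for x k
    using group.int_pow_closed[OF grp, of x k] pow[OF that] that by simp
  show ?thesis
  proof
    assume ?L
    then obtain g where g: "g \<in> H" "H = {g [^]\<^bsub>?H\<^esub> (k::int) | k. True}" and inf: "infinite H"
      by (auto simp: infinite_cyclic_group_def)
    have H: "H = {g [^] (k::int) | k. True}" using g pow by simp
    have gG: "g \<in> carrier G" using g sub by blast
    have "k = 0" if k: "g [^] (k::int) = \<one>" for k
    proof (rule ccontr)
      assume "k \<noteq> 0"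
      \<comment> \<open>Division with remainder by the absolute value of k reduces every power to a
        remainder.\<close>
      have "g [^] j \<in> (\<lambda>j. g [^] j) ` {0..<\<bar>k\<bar>}" for j :: int
      proof -
        have "g [^] \<bar>k\<bar> = \<one>"
          using k gG by (simp add: abs_if int_pow_neg)
        then have "g [^] (\<bar>k\<bar> * (j div \<bar>k\<bar>)) = \<one>"
          using gG int_pow_pow[of g "j div \<bar>k\<bar>" "\<bar>k\<bar>"] int_pow_pow[of g "\<bar>k\<bar>" "j div \<bar>k\<bar>"]
          by (simp add: mult.commute)
        then have "g [^] (\<bar>k\<bar> * (j div \<bar>k\<bar>) + j mod \<bar>k\<bar>) = g [^] (j mod \<bar>k\<bar>)"
          using gG int_pow_mult[of g "\<bar>k\<bar> * (j div \<bar>k\<bar>)" "j mod \<bar>k\<bar>"] by simp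
        then have "g [^] j = g [^] (j mod \<bar>k\<bar>)" by simp
        then show ?thesis using \<open>k \<noteq> 0\<close> by (auto intro!: image_eqI)
      qed
      then have "H \<subseteq> (\<lambda>j. g [^] j) ` {0..<\<bar>k\<bar>}" unfolding H by blast
      then show False using inf finite_surj[of "{0..<\<bar>k\<bar>}"] by blast
    qed
    then show ?R using g(1) H by blast
  next
    assume ?R
    then obtain x where x: "x \<in> H" "\<And>a. a \<in> H \<Longrightarrow> \<exists>k::int. a = x [^] k"
      and inj: "\<And>k::int. x [^] k = \<one> \<Longrightarrow> k = 0" by blast
    have xG: "x \<in> carrier G" using x sub by blast
    have "inj (\<lambda>k::int. x [^] k)"
    proof (rule injI)
      fix i j :: int assume "x [^] i = x [^] j"
      then have "x [^] (i - j) = \<one>" using xG by (simp add: int_pow_diff)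
      then show "i = j" using inj by force
    qed
    moreover have H: "H = range (\<lambda>k::int. x [^] k)" using x pow_in by blast
    ultimately have "infinite H" using finite_imageD[of "\<lambda>k::int. x [^] k" UNIV] infinite_UNIV_int by auto
    moreover have "H = {x [^]\<^bsub>?H\<^esub> (k::int) | k. True}" using pow[OF x(1)] H by auto
    ultimately show ?L using grp x(1) by (auto simp: infinite_cyclic_group_def)
  qed
qed

section \<open>Surjective brace homomorphisms, with the quotient maps as the intended
  instances\<close>

locale brace_hom = B: skew_brace B + C: skew_brace C
  for B :: "('a, 'b) brace_scheme" and C :: "('c, 'd) brace_scheme" +
  fixes h :: "'a \<Rightarrow> 'c"
  assumes add_hom: "h \<in> hom (addG B) (addG C)"
    and mul_hom: "h \<in> hom (mulG B) (mulG C)"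
    and surj: "h ` bcar B = bcar C"
begin

sublocale A: group_hom "addG B" "addG C" h
  using add_hom B.A.group_axioms C.A.group_axioms by (simp add: group_hom_def group_hom_axioms_def)

sublocale M: group_hom "mulG B" "mulG C" h
  using mul_hom B.M.group_axioms C.M.group_axioms by (simp add: group_hom_def group_hom_axioms_def)

lemma h_closed [simp, intro]: "a \<in> bcar B \<Longrightarrow> h a \<in> bcar C"
  using surj by blast

lemmas h_add [simp] = A.hom_mult[unfolded addG_sel]
lemmas h_mul [simp] = M.hom_mult[unfolded mulG_sel]
lemmas h_zero [simp] = A.hom_one[folded bzero_def]
lemmas h_neg [simp] = A.hom_inv[unfolded addG_sel, folded bneg_def]
lemmas h_minv [simp] = M.hom_inv[unfolded mulG_sel]
lemmas h_smul [simp] = A.hom_int_pow[unfolded addG_sel]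

lemma h_lam [simp]: "a \<in> bcar B \<Longrightarrow> b \<in> bcar B \<Longrightarrow> h (blam B a b) = blam C (h a) (h b)"
  by (simp add: blam_def)

lemma surjE: assumes "c \<in> bcar C" obtains b where "b \<in> bcar B" "c = h b"
  using assms surj by blast

definition pre :: "'c set \<Rightarrow> 'a set" where "pre L = {a \<in> bcar B. h a \<in> L}"

lemma pre_mono: "L \<subseteq> K \<Longrightarrow> pre L \<subseteq> pre K"
  by (auto simp: pre_def)

lemma image_pre: "L \<subseteq> bcar C \<Longrightarrow> h ` pre L = L"
  by (auto simp: pre_def image_iff elim!: surjE dest: subsetD)

lemma ideal_pre:
  assumes "is_ideal C L"
  shows "is_ideal B (pre L)"
  by (intro B.idealI B.subgroup_addI)
     (use C.ideal_add[OF assms] C.idealD[OF assms] in \<open>auto simp: pre_def\<close>)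

lemma ideal_image:
  assumes "is_ideal B J"
  shows "is_ideal C (h ` J)"
proof -
  note J = B.ideal_add[OF assms] B.idealD[OF assms]
  have *: "\<And>x. x \<in> J \<Longrightarrow> x \<in> bcar B" using J(1) by blast
  have 1: "h a \<in> h ` J" if "a \<in> J" for a using that by simp
  show ?thesis
  proof (intro C.idealI C.subgroup_addI)
    show "h ` J \<subseteq> bcar C" using * by auto
    show "bzero C \<in> h ` J" using 1[OF J(2)] by simp
    show "badd C a b \<in> h ` J" if "a \<in> h ` J" "b \<in> h ` J" for a b
      using that * 1[OF J(3)] by auto
    show "bneg C a \<in> h ` J" if "a \<in> h ` J" for a
      using that * 1[OF J(4)] by auto
    fix c x assume cx: "c \<in> bcar C" "x \<in> h ` J"
    then obtain b y where b: "b \<in> bcar B" "c = h b" and y: "y \<in> J" "y \<in> bcar B" "x = h y"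
      using * by (auto elim: surjE)
    show "blam C c x \<in> h ` J" using 1[OF J(6)[OF b(1) y(1)]] b y by simp
    show "badd C (badd C c x) (bneg C c) \<in> h ` J" using 1[OF J(7)[OF b(1) y(1)]] b y by simp
    show "bmul C (bmul C c x) (inv\<^bsub>mulG C\<^esub> c) \<in> h ` J" using 1[OF J(8)[OF b(1) y(1)]] b y by simp
  qed
qed

text \<open>If h a = h b with b in J, then a - b lies in the kernel and hence in J.\<close>

lemma pre_image:
  assumes "is_ideal B J" "pre {bzero C} \<subseteq> J"
  shows "pre (h ` J) = J"
proof
  note J = B.ideal_add[OF assms(1)]
  show "J \<subseteq> pre (h ` J)" using J(1) by (auto simp: pre_def)
  show "pre (h ` J) \<subseteq> J"
  proof
    fix a assume "a \<in> pre (h ` J)"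
    then obtain b where a: "a \<in> bcar B" and b: "b \<in> J" "h a = h b" by (auto simp: pre_def)
    have bB: "b \<in> bcar B" using b J(1) by blast
    have "badd B a (bneg B b) \<in> pre {bzero C}" using a b bB by (simp add: pre_def)
    then have "badd B (badd B a (bneg B b)) b \<in> J" using assms(2) J(3) b(1) by blast
    then show "a \<in> J" using a bB by (simp add: B.add_assoc)
  qed
qed

text \<open>The preimage of the coset of L at h a is the coset of \<open>pre L\<close> at a, and
  taking preimages is injective because h is onto. This is the isomorphism theorem for quotients at
  the level of cardinalities.\<close>

lemma card_subquot_pre:
  assumes "L \<subseteq> bcar C" "K \<subseteq> bcar C"
  shows "card (subquot B (pre K) (pre L)) = card (subquot C K L)"
proof -
  have coset: "pre L #>\<^bsub>addG B\<^esub> a = pre (L #>\<^bsub>addG C\<^esub> h a)" if a: "a \<in> bcar B" for a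
  proof
    show "pre L #>\<^bsub>addG B\<^esub> a \<subseteq> pre (L #>\<^bsub>addG C\<^esub> h a)"
      using a by (auto simp: pre_def r_coset_def)
    show "pre (L #>\<^bsub>addG C\<^esub> h a) \<subseteq> pre L #>\<^bsub>addG B\<^esub> a"
    proof
      fix b assume "b \<in> pre (L #>\<^bsub>addG C\<^esub> h a)"
      then obtain l where b: "b \<in> bcar B" and l: "l \<in> L" "h b = badd C l (h a)"
        by (auto simp: pre_def r_coset_def)
      have lC: "l \<in> bcar C" using l assms by blast
      have "badd B b (bneg B a) \<in> pre L" using a b l lC by (simp add: pre_def C.add_assoc)
      then show "b \<in> pre L #>\<^bsub>addG B\<^esub> a"
        using a b by (auto simp: r_coset_def B.add_assoc intro!: bexI[of _ "badd B b (bneg B a)"])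
    qed
  qed
  have eq: "subquot B (pre K) (pre L) = pre ` subquot C K L"
  proof
    show "subquot B (pre K) (pre L) \<subseteq> pre ` subquot C K L"
      by (auto simp: subquot_def pre_def[of K] coset)
    show "pre ` subquot C K L \<subseteq> subquot B (pre K) (pre L)"
    proof
      fix S assume "S \<in> pre ` subquot C K L"
      then obtain k where k: "k \<in> K" "S = pre (L #>\<^bsub>addG C\<^esub> k)" by (auto simp: subquot_def)
      then obtain a where "a \<in> bcar B" "k = h a" using assms surjE by blast
      then show "S \<in> subquot B (pre K) (pre L)" using k
        by (auto simp: subquot_def coset pre_def[of K])
    qed
  qed
  have inj: "inj_on pre (Pow (bcar C))"
  proof (rule inj_onI)
    fix S Y assume SY: "S \<in> Pow (bcar C)" "Y \<in> Pow (bcar C)" "pre S = pre Y"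
    then show "S = Y" by (metis image_pre PowD)
  qed
  have "subquot C K L \<subseteq> Pow (bcar C)"
    using assms by (auto simp: subquot_def r_coset_def)
  then show ?thesis unfolding eq by (intro card_image inj_on_subset[OF inj])
qed

text \<open>As h maps \<open>pre K\<close> onto K and the whole of B onto C, each quantifier over
  the target becomes one over the source, and membership of values of h becomes membership in
  preimages.\<close>

lemma soc_step_pre:
  assumes "L \<subseteq> bcar C" "K \<subseteq> bcar C"
  shows "soc_step B (pre L) (pre K) \<longleftrightarrow> soc_step C L K"
proof -
  have mem: "b \<in> pre S \<longleftrightarrow> h b \<in> S" if "b \<in> bcar B" for b S using that by (simp add: pre_def)
  have hK: "K = h ` pre K"
    using image_pre[OF assms(2)] ..
  have K: "(\<forall>x\<in>K. P x) \<longleftrightarrow> (\<forall>a\<in>pre K. P (h a))" "(\<exists>x\<in>K. P x) \<longleftrightarrow> (\<exists>a\<in>pre K. P (h a))" for P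
    by (subst hK, simp)+
  have Cq: "(\<forall>x\<in>bcar C. P x) \<longleftrightarrow> (\<forall>a\<in>bcar B. P (h a))" for P
    using surj by (metis image_iff)
  have pB: "a \<in> bcar B" if "a \<in> pre K" for a using that by (simp add: pre_def)
  show ?thesis unfolding soc_step_def K Cq
    by (intro arg_cong2[where f="(\<and>)"] bex_cong ball_cong all_cong refl) (auto simp: mem pB)
qed

text \<open>Over the zero ideal a difference lies in the ideal exactly if its two terms agree, which
  gives the equations defining \<open>bsoc\<close>.\<close>

lemma soc_step_zero_iff:
  assumes "subgroup J (addG C)"
  shows "soc_step C {bzero C} J \<longleftrightarrow>
    infinite_cyclic_group ((addG C)\<lparr>carrier := J\<rparr>) \<and> J \<subseteq> bsoc C"
proof -
  have J: "a \<in> bcar C" if "a \<in> J" for a using subgroup.subset[OF assms] that by auto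
  show ?thesis
    unfolding soc_step_def C.A.infinite_cyclic_group_iff[OF assms] bsoc_def bzero_def[symmetric]
    by (auto simp: C.diff_eq_zero_iff J)
qed

end

text \<open>\<open>addG\<close> and \<open>mulG\<close> select their identity by this description;
  the lemma identifies it with the identity of the factor groups when a quotient brace is
  formed.\<close>

lemma (in group) the_one: "(THE e. e \<in> carrier G \<and> (\<forall>x\<in>carrier G. e \<otimes> x = x \<and> x \<otimes> e = x)) = \<one>"
  by (rule the_equality) (auto dest: bspec[OF _ one_closed])

section \<open>The quotient brace and its socle\<close>

context skew_brace
begin

text \<open>For i in the ideal ai = a + \<lambda>_a(i), and \<lambda>_a permutes the ideal, so the
  left cosets agree; normality in both groups passes from left to right cosets.\<close>

lemma coset_eq:
  assumes I: "is_ideal B I" and a: "a \<in> bcar B"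
  shows "I #>\<^bsub>mulG B\<^esub> a = I #>\<^bsub>addG B\<^esub> a"
proof -
  note I' = ideal_add[OF I] idealD[OF I]
  have *: "\<And>x. x \<in> I \<Longrightarrow> x \<in> bcar B" using I' by blast
  have "I #>\<^bsub>mulG B\<^esub> a = a <#\<^bsub>mulG B\<^esub> I"
    using is_idealD(4)[OF I] a by (simp add: normal.coset_eq)
  also have "\<dots> = a <#\<^bsub>addG B\<^esub> I"
  proof -
    have "\<exists>j\<in>I. a \<boxdot> i = a \<boxplus> j" if "i \<in> I" for i
      using that * I'(6)[OF a] a by (auto simp: mul_eq)
    moreover have "\<exists>j\<in>I. a \<boxplus> i = a \<boxdot> j" if "i \<in> I" for i
      \<comment> \<open>The witness inverts \<lambda>_a on i, which stays in the ideal by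
        invariance.\<close>
      using that * I'(6)[of "minv a" i] a by (intro bexI[of _ "\<lambda>\<^sub>B (minv a) i"]) (auto simp: mul_eq)
    ultimately show ?thesis unfolding l_coset_def addG_sel mulG_sel by blast
  qed
  also have "\<dots> = I #>\<^bsub>addG B\<^esub> a"
    using is_idealD(3)[OF I] a by (simp add: normal.coset_eq)
  finally show ?thesis .
qed

lemma addG_bquot:
  assumes I: "is_ideal B I"
  shows "addG (bquot B I) = addG B Mod I"
proof -
  interpret Q: group "addG B Mod I" using normal.factorgroup_is_group[OF is_idealD(3)[OF I]] .
  show ?thesis
    using Q.the_one unfolding addG_def[of "bquot B I"] by (simp add: bquot_def FactGroup_def)
qed

lemma mulG_bquot:
  assumes I: "is_ideal B I"
  shows "mulG (bquot B I) = mulG B Mod I"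
proof -
  interpret Q: group "mulG B Mod I" using normal.factorgroup_is_group[OF is_idealD(4)[OF I]] .
  have "rcosets\<^bsub>mulG B\<^esub> I = rcosets\<^bsub>addG B\<^esub> I"
    using coset_eq[OF I] by (simp add: RCOSETS_def)
  then show ?thesis
    using Q.the_one unfolding mulG_def[of "bquot B I"] by (simp add: bquot_def FactGroup_def)
qed

text \<open>Both operations on cosets are those of factor groups, so the brace law only has to be
  checked on representatives.\<close>

lemma bquot_hom:
  assumes I: "is_ideal B I"
  shows "brace_hom B (bquot B I) (\<lambda>a. I #>\<^bsub>addG B\<^esub> a)"
proof -
  let ?Q = "bquot B I" and ?h = "\<lambda>a. I #>\<^bsub>addG B\<^esub> a"
  interpret QA: group "addG ?Q"
    using normal.factorgroup_is_group[OF is_idealD(3)[OF I]] by (simp add: addG_bquot[OF I])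
  interpret QM: group "mulG ?Q"
    using normal.factorgroup_is_group[OF is_idealD(4)[OF I]] by (simp add: mulG_bquot[OF I])
  have ah: "?h \<in> hom (addG B) (addG ?Q)"
    using normal.r_coset_hom_Mod[OF is_idealD(3)[OF I]] by (simp add: addG_bquot[OF I])
  have "(\<lambda>a. I #>\<^bsub>mulG B\<^esub> a) \<in> hom (mulG B) (mulG ?Q)"
    using normal.r_coset_hom_Mod[OF is_idealD(4)[OF I]] by (simp add: mulG_bquot[OF I])
  then have mh: "?h \<in> hom (mulG B) (mulG ?Q)"
    using coset_eq[OF I] by (auto simp: hom_def Pi_def)
  have surj: "?h ` bcar B = bcar ?Q" by (auto simp: bquot_def RCOSETS_def)
  interpret ah: group_hom "addG B" "addG ?Q" ?h
    using ah A.group_axioms QA.group_axioms by (simp add: group_hom_def group_hom_axioms_def)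
  have ne: "bneg ?Q (?h a) = ?h (\<boxminus> a)" if "a \<in> bcar B" for a
    using ah.hom_inv[of a] that by (simp add: bneg_def)
  have ad: "badd ?Q (?h a) (?h b) = ?h (a \<boxplus> b)" if "a \<in> bcar B" "b \<in> bcar B" for a b
    using ah that by (simp add: hom_def)
  have mu: "bmul ?Q (?h a) (?h b) = ?h (a \<boxdot> b)" if "a \<in> bcar B" "b \<in> bcar B" for a b
    using mh that by (simp add: hom_def)
  have "is_brace ?Q" unfolding is_brace_def
    using QA.group_axioms QM.group_axioms
    by (simp add: surj[symmetric] ne ad mu distrib)
  then show ?thesis
    using ah mh surj by (simp add: brace_hom_def brace_hom_axioms_def skew_brace_def brace)
qed

lemma bquot_kernel:
  assumes I: "is_ideal B I"
  shows "brace_hom.pre B (\<lambda>a. I #>\<^bsub>addG B\<^esub> a) {bzero (bquot B I)} = I"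
proof -
  interpret brace_hom B "bquot B I" "\<lambda>a. I #>\<^bsub>addG B\<^esub> a" using bquot_hom[OF I] .
  have "bzero (bquot B I) = I" by (simp add: bzero_def addG_bquot[OF I])
  moreover have "I #>\<^bsub>addG B\<^esub> a = I \<longleftrightarrow> a \<in> I" if "a \<in> bcar B" for a
    using A.coset_join1[OF _ _ is_idealD(1)[OF I], of a] A.coset_join2[OF _ is_idealD(1)[OF I], of a]
      that is_idealD(5)[OF I] by auto
  ultimately show ?thesis
    using is_idealD(5)[OF I] by (auto simp: pre_def)
qed

text \<open>Both sides are conditions on the image of J over the zero ideal of the quotient: one by
  definition, the other by pulling back, J being the full preimage of its image.\<close>

lemma soc_cyclic_step_iff:
  assumes I: "is_ideal B I" and J: "is_ideal B J" and "I \<subseteq> J"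
  shows "soc_cyclic_step B I J \<longleftrightarrow> soc_step B I J"
proof -
  let ?Q = "bquot B I" and ?h = "\<lambda>a. I #>\<^bsub>addG B\<^esub> a"
  interpret brace_hom B ?Q ?h using bquot_hom[OF I] .
  have ker: "pre {bzero ?Q} = I" using bquot_kernel[OF I] .
  have preJ: "pre (?h ` J) = J" using pre_image[OF J] ker assms(3) by simp
  have "soc_step B I J \<longleftrightarrow> soc_step ?Q {bzero ?Q} (?h ` J)"
    using soc_step_pre[of "{bzero ?Q}" "?h ` J"] is_idealD(5)[OF ideal_image[OF J]]
    by (simp add: ker preJ)
  also have "\<dots> \<longleftrightarrow> soc_cyclic_step B I J"
    using soc_step_zero_iff[OF is_idealD(1)[OF ideal_image[OF J]]]
    by (simp add: soc_cyclic_step_def subquot_addG_def subquot_def)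
  finally show ?thesis ..
qed

end

section \<open>Rearranging two adjacent factors\<close>

declare bzero_def [symmetric, simp]

section \<open>Subgroups of prime order\<close>

lemma (in group) card_subgroup_dvd:
  assumes "subgroup H G" "subgroup K G" "H \<subseteq> K"
  shows "card H dvd card K"
  using group.lagrange[OF subgroup_imp_group[OF assms(2)] subgroup_incl[OF assms(1,2,3)], symmetric]
  by (simp add: order_def)

text \<open>The subgroup generated by x has order dividing a prime and contains two distinct
  elements, so it is all of K.\<close>

lemma (in group) prime_order_cyclic:
  assumes "subgroup K G" "Factorial_Ring.prime (card K)" "x \<in> K" "x \<noteq> \<one>" "a \<in> K"
  shows "\<exists>k::int. a = x [^] k"
proof -
  have fin: "finite K" using assms(2) card.infinite not_prime_0 by metis
  have xG: "x \<in> carrier G" using assms subgroup.subset by blast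
  let ?P = "generate G {x}"
  have P: "subgroup ?P G" using generate_is_subgroup xG by simp
  have sub: "?P \<subseteq> K" using generate_subgroup_incl[of "{x}" K] assms by simp
  have "card ?P dvd card K" using card_subgroup_dvd[OF P assms(1) sub] .
  moreover have "card ?P \<noteq> 1"
  proof
    assume "card ?P = 1"
    then obtain y where "?P = {y}" by (auto simp: card_1_singleton_iff)
    moreover have "\<one> \<in> ?P" "x \<in> ?P" by (auto intro: generate.intros)
    ultimately show False using assms(4) by auto
  qed
  ultimately have "card ?P = card K" using assms(2) by (metis prime_nat_iff)
  then have "?P = K" using card_subset_eq[OF fin sub] by simp
  then show ?thesis using assms(5) generate_pow[OF xG] by auto
qed

lemma (in group) pow_card_subgroup:
  assumes "subgroup K G" "a \<in> K"
  shows "a [^] card K = \<one>"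
  using group.pow_order_eq_1[OF subgroup_imp_group[OF assms(1)], of a] assms(2)
  by (simp add: order_def nat_pow_consistent[symmetric])

text \<open>If the two subgroups met trivially, the products of their elements would be q*q distinct
  elements of K, more than p*q. The statement is for an arbitrary group because it is applied to
  both operations of a brace.\<close>

lemma (in group) unique_subgroup_order_pq:
  assumes K: "finite K" "card K = p * q" "p < q" "Factorial_Ring.prime q" "subgroup K G"
    and H: "subgroup H G" "H \<subseteq> K" "card H = q" and H': "subgroup H' G" "H' \<subseteq> K" "card H' = q"
  shows "H = H'"
proof -
  have int: "subgroup (H \<inter> H') G" using subgroups_Inter_pair H(1) H'(1) by simp
  have fin: "finite H" "finite H'" using K(1) H(2) H'(2) finite_subset by blast+
  have "card (H \<inter> H') dvd q" using card_subgroup_dvd[OF int H(1)] H(3) by simp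
  moreover have "card (H \<inter> H') \<noteq> 1"
  proof
    assume "card (H \<inter> H') = 1"
    then have triv: "H \<inter> H' = {\<one>}"
      using subgroup.one_closed[OF int] by (metis card_1_singletonE singletonD)
    have sub: "H \<subseteq> carrier G" "H' \<subseteq> carrier G" using H H' subgroup.subset by blast+
    have "inj_on (\<lambda>(x, y). x \<otimes> y) (H \<times> H')"
    proof (rule inj_onI, clarify)
      fix a b c d assume *: "a \<in> H" "b \<in> H'" "c \<in> H" "d \<in> H'" "a \<otimes> b = c \<otimes> d"
      have G: "a \<in> carrier G" "b \<in> carrier G" "c \<in> carrier G" "d \<in> carrier G" using * sub by blast+
      have "inv c \<otimes> a = inv c \<otimes> (c \<otimes> d) \<otimes> inv b"
        using G by (simp add: *(5)[symmetric] m_assoc)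
      also have "\<dots> = d \<otimes> inv b" using G by (simp add: m_assoc[symmetric])
      \<comment> \<open>Equal products yield an element common to both subgroups, which must be the
        identity.\<close>
      finally have eq: "inv c \<otimes> a = d \<otimes> inv b" .
      have "inv c \<otimes> a \<in> H" "d \<otimes> inv b \<in> H'"
        using * H(1) H'(1) by (auto simp: subgroup.m_closed subgroup.m_inv_closed)
      then have "inv c \<otimes> a = \<one>" "d \<otimes> inv b = \<one>" using triv eq by auto
      then show "a = c \<and> b = d" using G
        by (metis inv_equality inv_inv inv_closed)
    qed
    moreover have "(\<lambda>(x, y). x \<otimes> y) ` (H \<times> H') \<subseteq> K"
      using H(2) H'(2) subgroup.m_closed[OF K(5)] by auto
    ultimately have "card (H \<times> H') \<le> card K"
      using K(1) by (metis card_inj_on_le)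
    then have "q * q \<le> p * q" using H H' K by (simp add: card_cartesian_product)
    then show False using K(3) by simp
  qed
  ultimately have c: "card (H \<inter> H') = q" using K(4) by (metis prime_nat_iff)
  have "H \<inter> H' = H" "H \<inter> H' = H'"
    by (rule card_subset_eq; use c fin H H' in simp)+
  then show ?thesis by simp
qed

section \<open>Exchanging two prime factors\<close>

context skew_brace
begin

declare mul_one_eq [simp]

lemma inj_lam: "c \<in> bcar B \<Longrightarrow> inj_on (\<lambda>\<^sub>B c) (bcar B)"
  by (metis inj_onI lam_minv_cancel)

lemma conj_hom: "c \<in> bcar B \<Longrightarrow> (\<lambda>a. c \<boxplus> a \<boxplus> \<boxminus> c) \<in> hom (addG B) (addG B)"
  by (auto simp: hom_def add_assoc)

lemma mconj_hom: "c \<in> bcar B \<Longrightarrow> (\<lambda>a. c \<boxdot> a \<boxdot> minv c) \<in> hom (mulG B) (mulG B)"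
  by (auto simp: hom_def mul_assoc)

lemma lagrange_subquot:
  assumes "subgroup L (addG B)" "subgroup K (addG B)" "L \<subseteq> K"
  shows "card (subquot B K L) * card L = card K"
proof -
  have "rcosets\<^bsub>(addG B)\<lparr>carrier := K\<rparr>\<^esub> L = subquot B K L"
    by (auto simp: RCOSETS_def subquot_def r_coset_def)
  then show ?thesis
    using group.lagrange[OF A.subgroup_imp_group[OF assms(2)] A.subgroup_incl[OF assms(1,2,3)]]
    by (simp add: order_def)
qed

lemma card_subquot_zero:
  assumes "J \<subseteq> bcar B"
  shows "card (subquot B J {\<zero>\<^sub>B}) = card J"
proof -
  have "subquot B J {\<zero>\<^sub>B} = (\<lambda>a. {a}) ` J"
    unfolding subquot_def by (rule image_cong) (use assms in \<open>auto simp: r_coset_def\<close>)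
  then show ?thesis by (simp add: card_image)
qed

text \<open>A subgroup L of order q of the additive group of K is stable under \<lambda> and
  additive conjugation by uniqueness. Stability under \<lambda> makes L a multiplicative subgroup as
  well, and only then can uniqueness in the multiplicative group be used to show that L is normal
  there.\<close>

lemma swap_primes:
  assumes J: "is_ideal B J" and K: "is_ideal B K" and "J \<subseteq> K"
    and p: "Factorial_Ring.prime p" "card J = p"
    and q: "Factorial_Ring.prime q" "card (subquot B K J) = q" and "p < q"
  shows "\<exists>L. is_ideal B L \<and> L \<subseteq> K \<and> card L = q \<and> card (subquot B K L) = p"
proof -
  note Ks = is_idealD(1,2)[OF K] and Ki = idealD[OF K]
  have KB: "K \<subseteq> bcar B" using is_idealD(5)[OF K] .
  have cK: "card K = p * q"
    using lagrange_subquot[OF is_idealD(1)[OF J] Ks(1) \<open>J \<subseteq> K\<close>] p q by (simp add: mult.commute)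
  have fin: "finite K" using cK p q by (metis card.infinite mult_eq_0_iff not_prime_0)
  have "\<exists>H. subgroup H ((addG B)\<lparr>carrier := K\<rparr>) \<and> card H = q ^ 1"
    \<comment> \<open>The exponent is 1 and the cofactor is p.\<close>
    by (rule sylow_thm[of _ _ _ p])
       (use q cK fin A.subgroup_imp_group[OF Ks(1)] in \<open>simp_all add: order_def\<close>)
  then obtain L where L': "subgroup L ((addG B)\<lparr>carrier := K\<rparr>)" and cL: "card L = q" by auto
  have L: "subgroup L (addG B)" using A.incl_subgroup[OF Ks(1) L'] .
  have LK: "L \<subseteq> K" using subgroup.subset[OF L'] by simp
  \<comment> \<open>An injective endomorphism preserving K sends L to a subgroup of K of the same
    order q.\<close>
  have uniq: "f ` L = L" if f: "f \<in> hom (addG B) (addG B)" "f ` K \<subseteq> K" "inj_on f (bcar B)" for f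
  proof -
    interpret group_hom "addG B" "addG B" f
      using f A.group_axioms by (simp add: group_hom_def group_hom_axioms_def)
    have "inj_on f L" using inj_on_subset[OF f(3)] LK KB by blast
    then show ?thesis
      using A.unique_subgroup_order_pq[OF fin cK \<open>p < q\<close> q(1) Ks(1) subgroup_img_is_subgroup[OF L] _ _ L LK cL]
        f(2) LK cL by (auto simp: card_image)
  qed
  have lamL: "\<lambda>\<^sub>B b x \<in> L" if "b \<in> bcar B" "x \<in> L" for b x
    using uniq[OF lam_hom[OF that(1)] _ inj_lam[OF that(1)]] that Ki(1) by blast
  have conjL: "b \<boxplus> x \<boxplus> \<boxminus> b \<in> L" if "b \<in> bcar B" "x \<in> L" for b x
  proof -
    have "inj_on (\<lambda>a. b \<boxplus> a \<boxplus> \<boxminus> b) (bcar B)" using that by (intro inj_onI) simp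
    then show ?thesis using uniq[OF conj_hom[OF that(1)]] that Ki(2) by blast
  qed
  have Lm: "subgroup L (mulG B)" using left_ideal_subgroup_mulG[OF L lamL] .
  have mconjL: "b \<boxdot> x \<boxdot> minv b \<in> L" if b: "b \<in> bcar B" "x \<in> L" for b x
  proof -
    let ?f = "\<lambda>a. b \<boxdot> a \<boxdot> minv b"
    interpret group_hom "mulG B" "mulG B" ?f
      using mconj_hom[OF b(1)] M.group_axioms by (simp add: group_hom_def group_hom_axioms_def)
    have "inj_on ?f L" using b LK KB by (intro inj_onI) (simp add: subset_iff)
    then have "?f ` L = L"
      using M.unique_subgroup_order_pq[OF fin cK \<open>p < q\<close> q(1) Ks(2) subgroup_img_is_subgroup[OF Lm] _ _ Lm LK cL]
        b Ki(3) LK cL by (auto simp: card_image)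
    then show ?thesis using b by blast
  qed
  have "is_ideal B L" using idealI[OF L lamL conjL mconjL] .
  moreover have "card (subquot B K L) = p"
    using lagrange_subquot[OF L Ks(1) LK] cK cL q by auto
  ultimately show ?thesis using LK cL by blast
qed

section \<open>The socle and the ideals inside it\<close>

lemma soc_subset: "bsoc B \<subseteq> bcar B"
  by (auto simp: bsoc_def)

lemma socD:
  assumes "a \<in> bsoc B"
  shows "a \<in> bcar B" "\<And>b. b \<in> bcar B \<Longrightarrow> \<lambda>\<^sub>B a b = b" "\<And>b. b \<in> bcar B \<Longrightarrow> a \<boxplus> b = b \<boxplus> a"
    "\<And>b. b \<in> bcar B \<Longrightarrow> a \<boxdot> b = a \<boxplus> b"
  using assms by (auto simp: bsoc_def mul_eq)

text \<open>On the socle products are sums and multiplicative inverses are negatives, so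
  \<open>lam_mul\<close> computes \<lambda> at sums and negatives.\<close>

lemma soc_subgroup: "subgroup (bsoc B) (addG B)"
proof (rule subgroup_addI)
  fix a assume a: "a \<in> bsoc B"
  note a' = socD[OF a]
  have inv: "\<lambda>\<^sub>B (minv a) b = b" if "b \<in> bcar B" for b
    using lam_minv_cancel[of a b] a'(2)[OF that] a'(1) that by simp
  then have "minv a = \<boxminus> a" using minv_eq[OF a'(1)] a'(1) by simp
  moreover have "\<boxminus> a \<boxplus> b = b \<boxplus> \<boxminus> a" if b: "b \<in> bcar B" for b
  proof -
    have "\<boxminus> a \<boxplus> (b \<boxplus> a) \<boxplus> \<boxminus> a = \<boxminus> a \<boxplus> (a \<boxplus> b) \<boxplus> \<boxminus> a" using a'(3)[OF b] by simp
    then show ?thesis using a'(1) b by (simp add: add_assoc)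
  qed
  ultimately show "\<boxminus> a \<in> bsoc B" using inv a'(1) by (auto simp: bsoc_def)
  fix b assume b: "b \<in> bsoc B"
  note b' = socD[OF b]
  have "\<lambda>\<^sub>B (a \<boxplus> b) c = c" if "c \<in> bcar B" for c
    using a'(4)[OF b'(1)] lam_mul[of a b c] a'(1,2) b'(1,2) that by simp
  moreover have "a \<boxplus> b \<boxplus> c = c \<boxplus> (a \<boxplus> b)" if c: "c \<in> bcar B" for c
  proof -
    have "a \<boxplus> b \<boxplus> c = a \<boxplus> c \<boxplus> b" using a'(1) b'(1) b'(3)[OF c] c by (simp add: add_assoc)
    then show ?thesis using a'(1) b'(1) a'(3)[OF c] c by (simp add: add_assoc)
  qed
  ultimately show "a \<boxplus> b \<in> bsoc B" using a'(1) b'(1) by (simp add: bsoc_def)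
qed (auto simp: bsoc_def)

lemmas soc_add = subgroup_addD[OF soc_subgroup]

text \<open>Since \<lambda>_b(x) is in the socle, bx = b + \<lambda>_b(x) = \<lambda>_b(x) + b =
  \<lambda>_b(x)b. Multiplicative conjugation on L is therefore \<lambda>, and additive conjugation
  is trivial.\<close>

lemma ideal_in_socI:
  assumes "subgroup L (addG B)" "L \<subseteq> bsoc B" "\<And>b x. b \<in> bcar B \<Longrightarrow> x \<in> L \<Longrightarrow> \<lambda>\<^sub>B b x \<in> L"
  shows "is_ideal B L"
proof (rule idealI[OF assms(1,3)])
  fix b x assume b: "b \<in> bcar B" and x: "x \<in> L"
  have xs: "x \<in> bsoc B" "x \<in> bcar B" using x assms(2) socD by blast+
  have "b \<boxplus> x \<boxplus> \<boxminus> b = x" using socD(3)[OF xs(1) b, symmetric] xs(2) b by (simp add: add_assoc)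
  then show "b \<boxplus> x \<boxplus> \<boxminus> b \<in> L" using x by simp
  have l: "\<lambda>\<^sub>B b x \<in> L" using assms(3) b x .
  then have ls: "\<lambda>\<^sub>B b x \<in> bsoc B" using assms(2) by blast
  have "b \<boxdot> x = \<lambda>\<^sub>B b x \<boxdot> b"
    using mul_eq[OF b xs(2)] socD(3,4)[OF ls b] by simp
  then have "b \<boxdot> x \<boxdot> minv b = \<lambda>\<^sub>B b x" using b xs by (simp add: mul_assoc)
  then show "b \<boxdot> x \<boxdot> minv b \<in> L" using l by simp
qed

lemma soc_step_zero:
  assumes "J \<subseteq> bcar B"
  shows "soc_step B {\<zero>\<^sub>B} J \<longleftrightarrow>
    (\<exists>x\<in>J. (\<forall>a\<in>J. \<exists>k. a = k \<star> x) \<and> (\<forall>k. k \<star> x = \<zero>\<^sub>B \<longrightarrow> k = 0)) \<and> J \<subseteq> bsoc B"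
proof -
  have J: "a \<in> bcar B" if "a \<in> J" for a using that assms by auto
  show ?thesis
    unfolding soc_step_def bsoc_def by (auto simp: diff_eq_zero_iff J)
qed

section \<open>Factors of order 2\<close>

lemma mem_coset_iff:
  assumes "L \<subseteq> bcar B" "a \<in> bcar B" "b \<in> bcar B"
  shows "a \<in> L #>\<^bsub>addG B\<^esub> b \<longleftrightarrow> a \<boxplus> \<boxminus> b \<in> L"
  using assms by (auto simp: r_coset_def add_assoc subset_iff intro!: bexI[of _ "a \<boxplus> \<boxminus> b"])

lemma card_subquot_two:
  assumes L: "subgroup L (addG B)" and K: "K \<subseteq> bcar B" "L \<subseteq> K" and t: "t \<in> K" "t \<notin> L"
    and cov: "\<And>a. a \<in> K \<Longrightarrow> a \<in> L \<or> a \<boxplus> \<boxminus> t \<in> L"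
  shows "card (subquot B K L) = 2"
proof -
  note L' = subgroup_addD[OF L]
  note in_coset = mem_coset_iff[OF L'(1)]
  have c0: "L #>\<^bsub>addG B\<^esub> a = L" if "a \<in> L" for a
    using A.coset_join2[OF _ L that] that K by auto
  have "subquot B K L = {L, L #>\<^bsub>addG B\<^esub> t}"
  proof
    show "subquot B K L \<subseteq> {L, L #>\<^bsub>addG B\<^esub> t}"
    proof
      fix S assume "S \<in> subquot B K L"
      then obtain a where a: "a \<in> K" "S = L #>\<^bsub>addG B\<^esub> a" by (auto simp: subquot_def)
      have aB: "a \<in> bcar B" "t \<in> bcar B" using a t K by auto
      from cov[OF a(1)] show "S \<in> {L, L #>\<^bsub>addG B\<^esub> t}"
      proof
        assume "a \<in> L" then show ?thesis using a c0 by simp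
      next
        assume "a \<boxplus> \<boxminus> t \<in> L"
        then have "a \<in> L #>\<^bsub>addG B\<^esub> t" using in_coset aB by simp
        then show ?thesis using a A.repr_independence[of a L t] L aB by simp
      qed
    qed
    show "{L, L #>\<^bsub>addG B\<^esub> t} \<subseteq> subquot B K L"
      using t c0[OF L'(2)] L'(2) K unfolding subquot_def by (auto intro!: image_eqI[of _ _ "\<zero>\<^sub>B"])
  qed
  moreover have "L \<noteq> L #>\<^bsub>addG B\<^esub> t"
    using in_coset[of t t] t K L' by auto
  ultimately show ?thesis by simp
qed

lemma cyclic_subgroup:
  assumes "x \<in> bcar B"
  shows "subgroup (range (\<lambda>k. k \<star> x)) (addG B)"
proof (rule subgroup_addI)
  show "\<zero>\<^sub>B \<in> range (\<lambda>k. k \<star> x)" using smul_zero_left by (metis rangeI)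
qed (use assms in \<open>auto simp: smul_add_left[symmetric] smul_neg_left[symmetric]\<close>)

lemma smul_commute:
  assumes "x \<in> bcar B"
  shows "j \<star> x \<boxplus> k \<star> x = k \<star> x \<boxplus> j \<star> x"
  using assms by (simp add: smul_add_left[symmetric] add.commute)

text \<open>As the only nonzero element of J, z is fixed by \<lambda> and by both conjugations. Then
  z + \<lambda>_z(c) = zc = cz = c + \<lambda>_c(z) = c + z = z + c, whence \<lambda>_z(c) =
  c.\<close>

lemma order_two_ideal:
  assumes J: "is_ideal B J" and c: "card J = 2"
  obtains z where "J = {\<zero>\<^sub>B, z}" "z \<noteq> \<zero>\<^sub>B" "z \<in> bsoc B" "z \<boxplus> z = \<zero>\<^sub>B"
proof -
  note J' = ideal_add[OF J] idealD[OF J]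
  obtain z where z: "J = {\<zero>\<^sub>B, z}" "z \<noteq> \<zero>\<^sub>B"
    using c J'(2) by (auto simp: card_2_iff)
  have zB: "z \<in> bcar B" using z J' by auto
  have zJ: "z \<in> J" using z by simp
  have only: "a = z" if "a \<in> J" "a \<noteq> \<zero>\<^sub>B" for a using that z by auto
  have zz: "z \<boxplus> z = \<zero>\<^sub>B"
  proof (rule ccontr)
    assume "z \<boxplus> z \<noteq> \<zero>\<^sub>B"
    then have "z \<boxplus> z = z \<boxplus> \<zero>\<^sub>B" using only[OF J'(3)[OF zJ zJ]] zB by simp
    then show False using zB z(2) by (simp del: add_zero)
  qed
  have lz: "\<lambda>\<^sub>B c z = z" if "c \<in> bcar B" for c
  proof (rule only[OF J'(6)[OF that zJ]])
    show "\<lambda>\<^sub>B c z \<noteq> \<zero>\<^sub>B" using that zB z(2) by simp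
  qed
  have cz: "c \<boxplus> z = z \<boxplus> c" if c: "c \<in> bcar B" for c
  proof -
    have "c \<boxplus> z \<boxplus> \<boxminus> c = z"
    proof (rule only[OF J'(7)[OF c zJ]])
      show "c \<boxplus> z \<boxplus> \<boxminus> c \<noteq> \<zero>\<^sub>B"
        using c zB z(2) diff_eq_zero_iff[of "c \<boxplus> z" c] add_left_cancel[of c z "\<zero>\<^sub>B"] by auto
    qed
    then have "c \<boxplus> z \<boxplus> \<boxminus> c \<boxplus> c = z \<boxplus> c" by simp
    then show ?thesis using c zB by (simp add: add_assoc)
  qed
  have zc: "c \<boxdot> z = z \<boxdot> c" if c: "c \<in> bcar B" for c
  proof -
    have "c \<boxdot> z \<boxdot> minv c = z"
    proof (rule only[OF J'(8)[OF c zJ]])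
      show "c \<boxdot> z \<boxdot> minv c \<noteq> \<zero>\<^sub>B"
      proof
        assume "c \<boxdot> z \<boxdot> minv c = \<zero>\<^sub>B"
        then have "c \<boxdot> z \<boxdot> minv c \<boxdot> c = c" using c by simp
        then have "c \<boxdot> z = c \<boxdot> \<zero>\<^sub>B" using c zB by (simp add: mul_assoc)
        then show False using c zB z(2) by (simp del: mul_zero)
      qed
    qed
    then have "c \<boxdot> z \<boxdot> minv c \<boxdot> c = z \<boxdot> c" by simp
    then show ?thesis using c zB by (simp add: mul_assoc)
  qed
  have "\<lambda>\<^sub>B z c = c" if c: "c \<in> bcar B" for c
  proof -
    have "z \<boxplus> \<lambda>\<^sub>B z c = z \<boxplus> c"
      using mul_eq[OF zB c] mul_eq[OF c zB] zc[OF c] lz[OF c] cz[OF c] by simp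
    then show ?thesis using c zB by simp
  qed
  then have "z \<in> bsoc B" using zB cz by (auto simp: bsoc_def)
  then show ?thesis using that z zz by blast
qed

text \<open>A factor of order 2 below an infinite cyclic one generated by \<open>x\<close> acts on everything with
  order at most 2, so that \<open>2x\<close> already lies in the socle.\<close>

lemma swap_two_soc:
  assumes J: "is_ideal B J" and K: "is_ideal B K" and JK: "J \<subseteq> K"
    and c: "card J = 2" and s: "soc_step B J K"
  shows "\<exists>L M. is_ideal B L \<and> is_ideal B M \<and> L \<subseteq> M \<and> M \<subseteq> K \<and> soc_step B {\<zero>\<^sub>B} L \<and>
    card (subquot B M L) = 2 \<and> card (subquot B K M) = 2"
proof -
  obtain z where z: "J = {\<zero>\<^sub>B, z}" "z \<noteq> \<zero>\<^sub>B" "z \<in> bsoc B" "z \<boxplus> z = \<zero>\<^sub>B"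
    using order_two_ideal[OF J c] .
  note K' = ideal_add[OF K] idealD[OF K] and J' = ideal_add[OF J]
  have Js: "J \<subseteq> bsoc B" using z soc_add(2) by auto
  note Jsoc = socD[OF subsetD[OF Js]]
  have two: "j \<boxplus> j = \<zero>\<^sub>B" if "j \<in> J" for j using that z by auto
  obtain x where x: "x \<in> K" and gen: "\<And>a. a \<in> K \<Longrightarrow> \<exists>k. a \<boxplus> \<boxminus> (k \<star> x) \<in> J"
    and free: "\<And>k. k \<star> x \<in> J \<Longrightarrow> k = 0"
    and lamJ: "\<And>a b. a \<in> K \<Longrightarrow> b \<in> bcar B \<Longrightarrow> \<lambda>\<^sub>B a b \<boxplus> \<boxminus> b \<in> J"
    and comJ: "\<And>a b. a \<in> K \<Longrightarrow> b \<in> bcar B \<Longrightarrow> (a \<boxplus> b) \<boxplus> \<boxminus> (b \<boxplus> a) \<in> J"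
    using s unfolding soc_step_def by blast
  have xB: "x \<in> bcar B" using x K'(1) by blast
  have decomp: "\<exists>j\<in>J. \<exists>k. a = j \<boxplus> k \<star> x" if a: "a \<in> K" for a
  proof -
    obtain k where k: "a \<boxplus> \<boxminus> (k \<star> x) \<in> J" using gen[OF a] by blast
    have "a = (a \<boxplus> \<boxminus> (k \<star> x)) \<boxplus> k \<star> x" using a K'(1) xB by (simp add: add_assoc subset_iff)
    then show ?thesis using k by blast
  qed
  define w where "w = 2 \<star> x"
  have w2: "w = x \<boxplus> x" using smul_two[OF xB] w_def by simp
  have wB: "w \<in> bcar B" and wK: "w \<in> K" using xB x K'(5) by (simp_all add: w_def)
  have wk: "k \<star> w = (2 * k) \<star> x" for k using xB by (simp add: w_def smul_smul mult.commute)
  \<comment> \<open>Moving x past c costs a commutator j in J; moving both summands of w past c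
    costs j + j = 0.\<close>
  have central: "w \<boxplus> c = c \<boxplus> w" if c: "c \<in> bcar B" for c
  proof -
    define j where "j = (x \<boxplus> c) \<boxplus> \<boxminus> (c \<boxplus> x)"
    have j: "j \<in> J" using comJ[OF x c] j_def by simp
    note jB = Jsoc(1)[OF j]
    have xc: "x \<boxplus> c = j \<boxplus> (c \<boxplus> x)" using c xB by (simp add: j_def add_assoc neg_sum)
    have "w \<boxplus> c = x \<boxplus> (j \<boxplus> (c \<boxplus> x))" using c xB xc by (simp add: w2 add_assoc)
    also have "\<dots> = j \<boxplus> (x \<boxplus> (c \<boxplus> x))"
      using Jsoc(3)[OF j xB] c xB jB by (simp add: add_assoc[symmetric])
    also have "\<dots> = j \<boxplus> ((x \<boxplus> c) \<boxplus> x)" using c xB jB by (simp add: add_assoc)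
    also have "\<dots> = (j \<boxplus> j) \<boxplus> (c \<boxplus> (x \<boxplus> x))" using xc c xB jB by (simp add: add_assoc)
    also have "\<dots> = c \<boxplus> w" using two[OF j] c wB w2 by simp
    finally show ?thesis .
  qed
  \<comment> \<open>\<lambda>_x changes c by some j in J. It fixes j, since J has at most one
    nonzero element, so applying it twice adds j + j = 0.\<close>
  have lam_xx: "\<lambda>\<^sub>B (x \<boxdot> x) c = c" if c: "c \<in> bcar B" for c
  proof -
    define j where "j = \<lambda>\<^sub>B x c \<boxplus> \<boxminus> c"
    have j: "j \<in> J" using lamJ[OF x c] j_def by simp
    note jB = Jsoc(1)[OF j]
    have xc: "\<lambda>\<^sub>B x c = j \<boxplus> c" using c xB by (simp add: j_def add_assoc)
    have "\<lambda>\<^sub>B x j = j"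
    proof (cases "j = \<zero>\<^sub>B")
      case False
      have "\<lambda>\<^sub>B x j \<in> J" using idealD(1)[OF J xB j] .
      moreover have "\<lambda>\<^sub>B x j \<noteq> \<zero>\<^sub>B" using xB jB False by simp
      ultimately show ?thesis using j False z(1) by auto
    qed (use xB in simp)
    then have "\<lambda>\<^sub>B x (\<lambda>\<^sub>B x c) = (j \<boxplus> j) \<boxplus> c" using c xB jB by (simp add: xc lam_add add_assoc)
    then show ?thesis using two[OF j] c xB by (simp add: lam_mul)
  qed
  \<comment> \<open>The square of x is j times w for some j in J, and \<lambda>_j is trivial, so
    \<lambda>_w is the action of the square.\<close>
  have lam_w: "\<lambda>\<^sub>B w c = c" if c: "c \<in> bcar B" for c
  proof -
    define j where "j = \<lambda>\<^sub>B x x \<boxplus> \<boxminus> x"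
    have j: "j \<in> J" using lamJ[OF x xB] j_def by simp
    note jB = Jsoc(1)[OF j]
    have "\<lambda>\<^sub>B x x = j \<boxplus> x" using xB by (simp add: j_def add_assoc)
    then have "x \<boxdot> x = (x \<boxplus> j) \<boxplus> x" using xB jB by (simp add: mul_eq add_assoc)
    also have "\<dots> = j \<boxplus> w" using Jsoc(3)[OF j xB, symmetric] xB jB by (simp add: w2 add_assoc)
    also have "\<dots> = j \<boxdot> w" using Jsoc(4)[OF j wB] by simp
    finally have "\<lambda>\<^sub>B (x \<boxdot> x) c = \<lambda>\<^sub>B j (\<lambda>\<^sub>B w c)" using lam_mul[OF jB wB c] by simp
    then show ?thesis using lam_xx[OF c] Jsoc(2)[OF j] wB c by simp
  qed
  have w: "w \<in> bsoc B" using wB central lam_w by (auto simp: bsoc_def)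
  \<comment> \<open>If \<lambda>_c(x) = j + kx, then doubling removes j.\<close>
  have lam_w': "\<exists>k. \<lambda>\<^sub>B c w = k \<star> w" if c: "c \<in> bcar B" for c
  proof -
    obtain j k where jk: "j \<in> J" "\<lambda>\<^sub>B c x = j \<boxplus> k \<star> x" using decomp K'(6)[OF c x] by blast
    note jB = Jsoc(1)[OF jk(1)]
    have "\<lambda>\<^sub>B c w = 2 \<star> (j \<boxplus> k \<star> x)" using lam_smul[OF c xB] jk by (simp add: w_def)
    also have "\<dots> = 2 \<star> j \<boxplus> 2 \<star> (k \<star> x)"
      using smul_add_right[OF Jsoc(3)[OF jk(1)] jB] xB by simp
    also have "\<dots> = k \<star> w"
      using two[OF jk(1)] xB jB by (simp add: smul_two[OF jB] smul_smul wk mult.commute)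
    finally show ?thesis by blast
  qed
  define L where "L = range (\<lambda>k. k \<star> w)"
  have Lsub: "subgroup L (addG B)" using cyclic_subgroup[OF wB] by (simp add: L_def)
  have Ls: "L \<subseteq> bsoc B" using soc_add(5)[OF w] by (auto simp: L_def)
  have lamL: "\<lambda>\<^sub>B b y \<in> L" if b: "b \<in> bcar B" and y: "y \<in> L" for b y
  proof -
    obtain k where "y = k \<star> w" using y by (auto simp: L_def)
    moreover obtain m where "\<lambda>\<^sub>B b w = m \<star> w" using lam_w'[OF b] by blast
    ultimately show ?thesis using b wB by (auto simp: L_def lam_smul smul_smul)
  qed
  have L: "is_ideal B L" using ideal_in_socI[OF Lsub Ls lamL] .
  note L' = ideal_add[OF L]
  \<comment> \<open>M = J + L lies between L, generated by 2x, and K, which is J plus the multiples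
    of x. The element z represents the nontrivial coset below, and the parity of the coefficient of
    x decides the coset above.\<close>
  define M where "M = {j \<boxplus> l | j l. j \<in> J \<and> l \<in> L}"
  have MI: "j \<boxplus> l \<in> M" if "j \<in> J" "l \<in> L" for j l using that by (auto simp: M_def)
  have Ms: "M \<subseteq> bsoc B" using Js Ls soc_add(3) by (auto simp: M_def)
  have LB: "l \<in> bcar B" if "l \<in> L" for l using that L'(1) by blast
  have Msub: "subgroup M (addG B)"
  proof (rule subgroup_addI)
    show "M \<subseteq> bcar B" using Ms soc_subset by blast
    show "\<zero>\<^sub>B \<in> M" using MI[OF J'(2) L'(2)] by simp
    fix a assume "a \<in> M"
    then obtain j l where a: "j \<in> J" "l \<in> L" "a = j \<boxplus> l" by (auto simp: M_def)
    have jlB: "j \<in> bcar B" "l \<in> bcar B" using a Jsoc(1) LB by auto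
    have "\<boxminus> a = \<boxminus> j \<boxplus> \<boxminus> l" using neg_sum[of l j] Jsoc(3)[OF a(1) jlB(2)] a jlB by simp
    then show "\<boxminus> a \<in> M" using MI[OF J'(4)[OF a(1)] L'(4)[OF a(2)]] by simp
    fix b assume "b \<in> M"
    then obtain i k where b: "i \<in> J" "k \<in> L" "b = i \<boxplus> k" by (auto simp: M_def)
    have ikB: "i \<in> bcar B" "k \<in> bcar B" using b Jsoc(1) LB by auto
    have "a \<boxplus> b = j \<boxplus> (l \<boxplus> i) \<boxplus> k" using a(3) b(3) jlB ikB by (simp add: add_assoc)
    also have "\<dots> = (j \<boxplus> i) \<boxplus> (l \<boxplus> k)" using jlB ikB Jsoc(3)[OF b(1) jlB(2), symmetric] by (simp add: add_assoc)
    finally show "a \<boxplus> b \<in> M" using MI[OF J'(3)[OF a(1) b(1)] L'(3)[OF a(2) b(2)]] by simp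
  qed
  have M: "is_ideal B M"
  proof (rule ideal_in_socI[OF Msub Ms])
    fix b y assume b: "b \<in> bcar B" "y \<in> M"
    then obtain j l where y: "j \<in> J" "l \<in> L" "y = j \<boxplus> l" by (auto simp: M_def)
    then show "\<lambda>\<^sub>B b y \<in> M"
      using MI[OF idealD(1)[OF J b(1) y(1)] lamL[OF b(1) y(2)]] b Jsoc(1) LB by (simp add: lam_add)
  qed
  have LM: "L \<subseteq> M" using MI[OF J'(2)] LB by force
  have LK: "L \<subseteq> K" using wK K'(5) by (auto simp: L_def)
  have MK: "M \<subseteq> K" using LK JK K'(3) by (auto simp: M_def)
  have free_w: "k = 0" if "k \<star> w \<in> J" for k using free[of "2 * k"] that by (simp add: wk)
  have step: "soc_step B {\<zero>\<^sub>B} L"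
  proof -
    have "w \<in> L" using wB by (auto simp: L_def intro!: range_eqI[of _ _ 1])
    moreover have "k = 0" if "k \<star> w = \<zero>\<^sub>B" for k using free_w that J'(2) by simp
    moreover have "\<exists>k. a = k \<star> w" if "a \<in> L" for a using that by (auto simp: L_def)
    ultimately show ?thesis unfolding soc_step_zero[OF L'(1)] using Ls by blast
  qed
  have zB: "z \<in> bcar B" using socD z by blast
  have "card (subquot B M L) = 2"
  proof (rule card_subquot_two[OF Lsub _ LM])
    show "M \<subseteq> bcar B" using Ms soc_subset by blast
    show "z \<in> M" using MI[of z "\<zero>\<^sub>B"] z(1) L'(2) zB by simp
    show "z \<notin> L"
    proof
      assume "z \<in> L"
      then obtain k where k: "z = k \<star> w" by (auto simp: L_def)
      then have "k = 0" using free_w z(1) by auto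
      then show False using k z(2) by simp
    qed
    fix a assume "a \<in> M"
    then obtain j l where a: "j \<in> J" "l \<in> L" "a = j \<boxplus> l" by (auto simp: M_def)
    have lB: "l \<in> bcar B" using LB a by blast
    have "z \<boxplus> l \<boxplus> \<boxminus> z = l" using socD(3)[OF z(3) lB] zB lB by (simp add: add_assoc)
    then show "a \<in> L \<or> a \<boxplus> \<boxminus> z \<in> L" using a z(1) lB by auto
  qed
  moreover have "card (subquot B K M) = 2"
  proof (rule card_subquot_two[OF Msub K'(1) MK x])
    show "x \<notin> M"
    proof
      assume "x \<in> M"
      then obtain j k where jk: "j \<in> J" "x = j \<boxplus> k \<star> w" by (auto simp: M_def L_def)
      note jB = Jsoc(1)[OF jk(1)]
      \<comment> \<open>If x were in M, this multiple of x would lie in J, and an odd number would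
        have to vanish.\<close>
      have e: "(1 - 2 * k) \<star> x = x \<boxplus> \<boxminus> (k \<star> w)" using xB by (simp add: smul_diff_left wk)
      have "x \<boxplus> \<boxminus> (k \<star> w) = j \<boxplus> k \<star> w \<boxplus> \<boxminus> (k \<star> w)" by (subst jk(2)) simp
      also have "\<dots> = j" using jB wB by (simp add: add_assoc)
      finally have "1 - 2 * k = 0" using free[of "1 - 2 * k"] jk(1) e by metis
      then show False by presburger
    qed
    fix a assume "a \<in> K"
    then obtain j k where a: "j \<in> J" "a = j \<boxplus> k \<star> x" using decomp by blast
    note jB = Jsoc(1)[OF a(1)]
    show "a \<in> M \<or> a \<boxplus> \<boxminus> x \<in> M"
    proof (cases "even k")
      case True
      then obtain m where "k = 2 * m" by (elim evenE)
      then have "a = j \<boxplus> m \<star> w" using a by (simp add: wk)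
      then show ?thesis using MI[OF a(1)] by (auto simp: L_def)
    next
      case False
      then obtain m where k: "k = 2 * m + 1" by (elim oddE)
      have "a \<boxplus> \<boxminus> x = j \<boxplus> (2 * m) \<star> x"
        using jB xB by (simp add: a(2) k smul_add_left add_assoc)
      then have "a \<boxplus> \<boxminus> x = j \<boxplus> m \<star> w" by (simp add: wk)
      then show ?thesis using MI[OF a(1)] by (auto simp: L_def)
    qed
  qed
  ultimately show ?thesis using L M LM MK step by blast
qed

section \<open>An odd prime above an infinite cyclic factor\<close>

lemma prime_index:
  assumes J: "is_ideal B J" and K: "is_ideal B K" and JK: "J \<subseteq> K"
    and p: "Factorial_Ring.prime p" "card (subquot B K J) = p" and a: "a \<in> K"
  shows "int p \<star> a \<in> J" "a \<up> p \<in> J" "\<And>x. x \<in> K \<Longrightarrow> x \<notin> J \<Longrightarrow> \<exists>k. a \<boxplus> \<boxminus> (k \<star> x) \<in> J"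
proof -
  let ?Q = "bquot B J" and ?h = "\<lambda>a. J #>\<^bsub>addG B\<^esub> a"
  interpret H: brace_hom B ?Q ?h using bquot_hom[OF J] .
  have ker: "b \<in> J \<longleftrightarrow> ?h b = bzero ?Q" if "b \<in> bcar B" for b
    using bquot_kernel[OF J] that by (auto simp: H.pre_def)
  have KB: "b \<in> bcar B" if "b \<in> K" for b using is_idealD(5)[OF K] that by blast
  have hK: "is_ideal ?Q (?h ` K)" using H.ideal_image[OF K] .
  have c: "card (?h ` K) = p" using p by (simp add: subquot_def)
  \<comment> \<open>The image of K has order p, so p-th powers vanish in it for both
    operations.\<close>
  have "?h a [^]\<^bsub>addG ?Q\<^esub> p = bzero ?Q" "?h a [^]\<^bsub>mulG ?Q\<^esub> p = bzero ?Q"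
    using H.C.A.pow_card_subgroup[OF is_idealD(1)[OF hK], of "?h a"]
      H.C.M.pow_card_subgroup[OF is_idealD(2)[OF hK], of "?h a"] a c
    by simp_all
  then show "int p \<star> a \<in> J" "a \<up> p \<in> J"
    using KB[OF a] A.nat_pow_closed[of a p] H.A.hom_nat_pow[of a p] H.M.hom_nat_pow[of a p]
    by (simp_all add: ker int_pow_int)
  fix x assume x: "x \<in> K" "x \<notin> J"
  obtain k :: int where k: "?h a = ?h x [^]\<^bsub>addG ?Q\<^esub> k"
    using H.C.A.prime_order_cyclic[OF is_idealD(1)[OF hK], of "?h x" "?h a"] a x c p ker[OF KB[OF x(1)]]
    by auto
  then have "a \<boxplus> \<boxminus> (k \<star> x) \<in> J"
    using KB[OF a] KB[OF x(1)] by (simp add: ker)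
  then show "\<exists>k. a \<boxplus> \<boxminus> (k \<star> x) \<in> J" by blast
qed

text \<open>If \<lambda>_a negated y, so would its p-th power because p is odd, and then 2y =
  0.\<close>

lemma lam_odd_power:
  assumes a: "a \<in> bcar B" and y: "y \<in> bcar B" and pm: "\<lambda>\<^sub>B a y = y \<or> \<lambda>\<^sub>B a y = \<boxminus> y"
    and p: "odd p" "\<lambda>\<^sub>B (a \<up> p) y = y" and two: "y \<boxplus> y \<noteq> \<zero>\<^sub>B"
  shows "\<lambda>\<^sub>B a y = y"
proof (rule ccontr)
  assume "\<lambda>\<^sub>B a y \<noteq> y"
  then have m: "\<lambda>\<^sub>B a y = \<boxminus> y" using pm by blast
  have "\<lambda>\<^sub>B (a \<up> n) y = (if even n then y else \<boxminus> y)" for n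
    by (induction n) (use a y m in \<open>simp_all add: lam_mul lam_neg\<close>)
  then have "\<boxminus> y = y" using p by metis
  then have "y \<boxplus> y = y \<boxplus> \<boxminus> y" by simp
  then show False using two y by simp
qed

text \<open>\<lambda>_c and its inverse multiply z by integers with product 1, and the only integer
  units are 1 and -1.\<close>

lemma lam_cyclic_unit:
  assumes z: "z \<in> bcar B" and free: "\<And>k. k \<star> z = \<zero>\<^sub>B \<Longrightarrow> k = 0"
    and inv: "\<And>c. c \<in> bcar B \<Longrightarrow> \<exists>k. \<lambda>\<^sub>B c z = k \<star> z" and c: "c \<in> bcar B"
  shows "\<lambda>\<^sub>B c z = z \<or> \<lambda>\<^sub>B c z = \<boxminus> z"
proof -
  obtain e where e: "\<lambda>\<^sub>B c z = e \<star> z" using inv[OF c] by blast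
  obtain d where d: "\<lambda>\<^sub>B (minv c) z = d \<star> z" using inv[OF minv_closed[OF c]] by blast
  have "z = \<lambda>\<^sub>B c (\<lambda>\<^sub>B (minv c) z)" using c z by simp
  also have "\<dots> = (e * d) \<star> z" using c z by (simp add: d e lam_smul smul_smul)
  finally have "(e * d - 1) \<star> z = \<zero>\<^sub>B" using z by (simp add: smul_diff_left)
  then have "e * d = 1" using free by force
  then have "e = 1 \<or> e = -1" by (simp add: zmult_eq_1_iff) blast
  then show ?thesis using e z by (auto simp: smul_neg_left)
qed

text \<open>Conjugating \<open>z^p\<close>, which lies in the socle, in two ways shows that \<open>c z = \<lambda>\<^sub>c(z) c\<close> for all \<open>c\<close>;
  this is equivalent to \<open>\<lambda>\<^sub>z(c) = c\<close> up to replacing \<open>z\<close> by its inverse.\<close>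

lemma odd_root_soc:
  assumes K: "is_ideal B K" and z: "z \<in> K" and gen: "\<And>a. a \<in> K \<Longrightarrow> \<exists>k. a = k \<star> z"
    and free: "\<And>k. k \<star> z = \<zero>\<^sub>B \<Longrightarrow> k = 0"
    and p: "odd p" and pow: "\<And>a. a \<in> K \<Longrightarrow> a \<up> p \<in> bsoc B"
  shows "z \<in> bsoc B"
proof -
  note K' = ideal_add[OF K] idealD[OF K]
  have KB: "a \<in> bcar B" if "a \<in> K" for a using K'(1) that by blast
  note zB = KB[OF z]
  have p0: "int p \<noteq> 0" using p by (cases p) auto
  have two: "z \<boxplus> z \<noteq> \<zero>\<^sub>B" using free[of 2] smul_two[OF zB] by auto
  have unit: "\<lambda>\<^sub>B c z = z \<or> \<lambda>\<^sub>B c z = \<boxminus> z" if "c \<in> bcar B" for c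
    by (rule lam_cyclic_unit[OF zB free _ that]) (use gen K'(6) z in blast)+
  \<comment> \<open>The p-th power of an element of K acts trivially and p is odd, which excludes
    the sign -1. Consequently multiplication on K is addition.\<close>
  have lam_z: "\<lambda>\<^sub>B a z = z" if a: "a \<in> K" for a
    by (rule lam_odd_power[OF KB[OF a] zB unit[OF KB[OF a]] p _ two])
       (use socD(2)[OF pow[OF a]] zB in simp)
  have lamK: "\<lambda>\<^sub>B a b = b" if a: "a \<in> K" and "b \<in> K" for a b
    using gen[OF that(2)] lam_z[OF a] KB[OF a] zB by (auto simp: lam_smul)
  have mulK: "a \<boxdot> b = a \<boxplus> b" if "a \<in> K" "b \<in> K" for a b
    using lamK that KB by (simp add: mul_eq)
  have powK: "a \<up> n = int n \<star> a" if a: "a \<in> K" for a n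
  proof (induction n)
    case (Suc n)
    have "a \<up> Suc n = int n \<star> a \<boxplus> a" using Suc mulK[OF K'(5)[OF a] a] by simp
    also have "\<dots> = int (Suc n) \<star> a" using smul_add_left[of a "int n" 1] KB[OF a] by (simp add: add.commute)
    finally show ?case .
  qed simp
  have pz: "int p \<star> z \<in> bsoc B" using pow[OF z] powK[OF z] by simp
  have cancel: "i = k" if "(int p * i) \<star> z = (int p * k) \<star> z" for i k
  proof -
    have "(int p * i - int p * k) \<star> z = \<zero>\<^sub>B" using that zB by (simp add: smul_diff_left)
    then show ?thesis using free p0 by force
  qed
  \<comment> \<open>Additive conjugation by c multiplies z by some k; as pz is central, pk =
    p.\<close>
  have central: "c \<boxplus> z = z \<boxplus> c" if c: "c \<in> bcar B" for c
  proof -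
    obtain k where k: "c \<boxplus> z \<boxplus> \<boxminus> c = k \<star> z" using gen[OF K'(7)[OF c z]] by blast
    have "c \<boxplus> int p \<star> z \<boxplus> \<boxminus> c = int p \<star> (k \<star> z)"
      using hom_int_pow[OF conj_hom[OF c], of z "int p"] A.group_axioms zB k by simp
    moreover have "c \<boxplus> int p \<star> z \<boxplus> \<boxminus> c = int p \<star> z"
      using socD(3)[OF pz c, symmetric] c zB by (simp add: add_assoc)
    ultimately have "(int p * k) \<star> z = (int p * 1) \<star> z" using zB by (simp add: smul_smul mult.commute)
    then have "k = 1" by (rule cancel)
    then have "c \<boxplus> z \<boxplus> \<boxminus> c \<boxplus> c = z \<boxplus> c" using k zB by simp
    then show ?thesis using c zB by (simp add: add_assoc)
  qed
  \<comment> \<open>The multiplicative conjugate w of z by c is mz, while \<lambda>_c(z) = ez.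
    Taking p-th powers moves the comparison to the socle, where multiplicative conjugation is
    \<lambda>, and gives pm = pe.\<close>
  have fix_unit: "\<lambda>\<^sub>B (\<lambda>\<^sub>B c z) c = c" if c: "c \<in> bcar B" for c
  proof -
    obtain e where e: "\<lambda>\<^sub>B c z = e \<star> z" using gen[OF K'(6)[OF c z]] by blast
    define w where "w = c \<boxdot> z \<boxdot> minv c"
    have wK: "w \<in> K" using K'(8)[OF c z] w_def by simp
    note wB = KB[OF wK]
    obtain m where m: "w = m \<star> z" using gen[OF wK] by blast
    have cz: "c \<boxdot> z = w \<boxdot> c" using c zB by (simp add: w_def mul_assoc)
    have "w \<up> p = c \<boxdot> (z \<up> p) \<boxdot> minv c"
      using hom_nat_pow[OF mconj_hom[OF c], of z p] M.group_axioms zB by (simp add: w_def)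
    then have wp: "int p \<star> (m \<star> z) \<boxdot> c = c \<boxdot> (int p \<star> z)"
      using powK[OF wK] powK[OF z] c zB by (simp add: m mul_assoc)
    have l: "\<lambda>\<^sub>B c (int p \<star> z) = e \<star> (int p \<star> z)"
      using c zB by (simp add: lam_smul e smul_smul mult.commute)
    have ls: "e \<star> (int p \<star> z) \<in> bsoc B" using soc_add(5)[OF pz] .
    have "c \<boxdot> (int p \<star> z) = e \<star> (int p \<star> z) \<boxdot> c"
      using mul_eq[OF c, of "int p \<star> z"] zB l socD(3,4)[OF ls c] by simp
    then have "int p \<star> (m \<star> z) = e \<star> (int p \<star> z)"
      using wp c zB by simp
    then have "(int p * m) \<star> z = (int p * e) \<star> z" using zB by (simp add: smul_smul mult.commute)
    then have "w = e \<star> z" using cancel m by blast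
    moreover have "c \<boxplus> e \<star> z = e \<star> z \<boxplus> c"
      using unit[OF c] unfolding e
    proof
      assume *: "e \<star> z = \<boxminus> z"
      have "\<boxminus> z \<boxplus> (c \<boxplus> z) \<boxplus> \<boxminus> z = \<boxminus> z \<boxplus> (z \<boxplus> c) \<boxplus> \<boxminus> z" using central[OF c] by simp
      then show ?thesis using * c zB by (simp add: add_assoc)
    qed (use central[OF c] in simp)
    \<comment> \<open>Both sides are cz: on the left as wc, on the right as c + ez with the summands
      exchanged and ez = w.\<close>
    ultimately have "w \<boxplus> \<lambda>\<^sub>B w c = w \<boxplus> c"
      using cz mul_eq[OF c zB] mul_eq[OF wB c] e by simp
    then show ?thesis using \<open>w = e \<star> z\<close> e wB c by simp
  qed
  have "\<lambda>\<^sub>B z c = c" if c: "c \<in> bcar B" for c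
    using unit[OF c]
  proof
    assume "\<lambda>\<^sub>B c z = z" then show ?thesis using fix_unit[OF c] by simp
  next
    \<comment> \<open>Here \<open>fix_unit\<close> says that \<lambda> of -z fixes c; multiplication
      on K being addition, -z is the multiplicative inverse of z, so \<lambda>_z fixes c
      too.\<close>
    assume *: "\<lambda>\<^sub>B c z = \<boxminus> z"
    have "z \<boxdot> \<boxminus> z = \<zero>\<^sub>B" using mulK[OF z K'(4)[OF z]] zB by simp
    then have "\<lambda>\<^sub>B z (\<lambda>\<^sub>B (\<boxminus> z) c) = c" using zB c by (simp add: lam_mul[symmetric])
    then show ?thesis using fix_unit[OF c] * by simp
  qed
  then show ?thesis using zB central by (auto simp: bsoc_def)
qed

text \<open>With \<open>J\<close> generated by \<open>y\<close>, an element \<open>x\<close> outside \<open>J\<close> and \<open>px = my\<close>: if \<open>p\<close> does not divide \<open>m\<close>,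
  then \<open>K\<close> is itself infinite cyclic, otherwise the torsion of \<open>K\<close> has order \<open>p\<close>.\<close>

lemma swap_soc_odd:
  assumes J: "is_ideal B J" and K: "is_ideal B K" and JK: "J \<subseteq> K"
    and s: "soc_step B {\<zero>\<^sub>B} J"
    and p: "Factorial_Ring.prime p" "odd p" "card (subquot B K J) = p"
  shows "soc_step B {\<zero>\<^sub>B} K \<or>
    (\<exists>L. is_ideal B L \<and> L \<subseteq> K \<and> card L = p \<and> soc_step B L K)"
proof -
  note K' = ideal_add[OF K] idealD[OF K] and J' = ideal_add[OF J]
  have KB: "a \<in> bcar B" if "a \<in> K" for a using K'(1) that by blast
  obtain y where y: "y \<in> J" and genJ: "\<And>a. a \<in> J \<Longrightarrow> \<exists>k. a = k \<star> y"
    and free: "\<And>k. k \<star> y = \<zero>\<^sub>B \<Longrightarrow> k = 0" and Js: "J \<subseteq> bsoc B"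
    using s unfolding soc_step_zero[OF J'(1)] by blast
  note Jsoc = socD[OF subsetD[OF Js]]
  note yB = Jsoc(1)[OF y]
  have p0: "int p \<noteq> 0" using p(2) by (cases p) auto
  note idx = prime_index[OF J K JK p(1,3)]
  have "J \<noteq> K"
  proof
    assume JK: "J = K"
    have "J #>\<^bsub>addG B\<^esub> a = J" if "a \<in> J" for a
      using A.coset_join2[OF _ is_idealD(1)[OF J] that] that J'(1) by auto
    then have "subquot B K J \<subseteq> {J}" unfolding subquot_def JK[symmetric] by blast
    then have "card (subquot B K J) \<le> card {J}" by (intro card_mono) auto
    then have "p \<le> 1" using p(3) by simp
    then show False using prime_gt_1_nat[OF p(1)] by linarith
  qed
  then obtain x where x: "x \<in> K" "x \<notin> J" using JK by blast
  note xB = KB[OF x(1)]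
  have decomp: "\<exists>i k. a = i \<star> y \<boxplus> k \<star> t" if a: "a \<in> K" and t: "t \<in> K" "t \<notin> J" for a t
  proof -
    obtain k where k: "a \<boxplus> \<boxminus> (k \<star> t) \<in> J" using idx(3)[OF a t] by blast
    have "a = (a \<boxplus> \<boxminus> (k \<star> t)) \<boxplus> k \<star> t" using KB[OF a] KB[OF t(1)] by (simp add: add_assoc)
    then show ?thesis using genJ[OF k] by metis
  qed
  have yc: "(k \<star> y) \<boxplus> b = b \<boxplus> k \<star> y" if "b \<in> bcar B" for b k using Jsoc(3)[OF J'(5)[OF y] that] .
  \<comment> \<open>J is additively central and K/J is generated by the class of x, so K is
    additively abelian.\<close>
  have comm: "a \<boxplus> b = b \<boxplus> a" if a: "a \<in> K" and b: "b \<in> K" for a b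
  proof -
    obtain i k where ik: "a = i \<star> y \<boxplus> k \<star> x" using decomp[OF a x] by blast
    obtain i' k' where ik': "b = i' \<star> y \<boxplus> k' \<star> x" using decomp[OF b x] by blast
    have "a \<boxplus> b = i \<star> y \<boxplus> (k \<star> x \<boxplus> i' \<star> y) \<boxplus> k' \<star> x"
      using xB yB by (simp add: ik ik' add_assoc)
    also have "\<dots> = (i \<star> y \<boxplus> i' \<star> y) \<boxplus> (k \<star> x \<boxplus> k' \<star> x)"
      using xB yB yc[of "k \<star> x" i', symmetric] by (simp add: add_assoc)
    also have "\<dots> = (i' \<star> y \<boxplus> i \<star> y) \<boxplus> (k' \<star> x \<boxplus> k \<star> x)"
      using smul_commute[OF yB] smul_commute[OF xB] by metis
    also have "\<dots> = i' \<star> y \<boxplus> (i \<star> y \<boxplus> k' \<star> x) \<boxplus> k \<star> x"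
      using xB yB by (simp add: add_assoc)
    also have "\<dots> = b \<boxplus> a"
      using xB yB yc[of "k' \<star> x" i] by (simp add: ik ik' add_assoc)
    finally show ?thesis .
  qed
  have powJ: "a \<up> p \<in> bsoc B" if "a \<in> K" for a using idx(2)[OF that] Js by blast
  obtain m where m: "int p \<star> x = m \<star> y" using genJ[OF idx(1)[OF x(1)]] by blast
  show ?thesis
  proof (cases "int p dvd m")
    case False
    then have "coprime (int p) m" using p(1) by (intro prime_imp_coprime) auto
    then obtain u v where uv: "u * int p + v * m = 1"
      by (metis bezout_int coprime_imp_gcd_eq_1)
    \<comment> \<open>The Bezout coefficients are chosen so that pz = y and mz = x; since y and x
      generate K, so does z.\<close>
    define z where "z = u \<star> y \<boxplus> v \<star> x"
    have yK: "y \<in> K" using y JK by blast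
    have zK: "z \<in> K" using K'(3,5) x yK by (simp add: z_def)
    note zB = KB[OF zK]
    have zk: "k \<star> z = (k * u) \<star> y \<boxplus> (k * v) \<star> x" for k
      using smul_add_right[OF yc, of "v \<star> x" u k] xB yB by (simp add: z_def smul_smul mult.commute)
    have pz: "int p \<star> z = y"
    proof -
      have "int p \<star> z = (int p * u) \<star> y \<boxplus> v \<star> (int p \<star> x)" using xB by (simp add: zk smul_smul)
      also have "\<dots> = (u * int p + v * m) \<star> y" using yB by (simp add: m smul_smul smul_add_left mult.commute)
      finally show ?thesis using uv yB by simp
    qed
    have mz: "m \<star> z = x"
    proof -
      have "m \<star> z = u \<star> (m \<star> y) \<boxplus> (m * v) \<star> x" using yB by (simp add: zk smul_smul)
      also have "\<dots> = (u * int p + v * m) \<star> x"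
        using xB by (simp add: m[symmetric] smul_smul smul_add_left mult.commute)
      finally show ?thesis using uv xB by simp
    qed
    have gen: "\<exists>k. a = k \<star> z" if a: "a \<in> K" for a
    proof -
      obtain i k where "a = i \<star> y \<boxplus> k \<star> x" using decomp[OF a x] by blast
      then have "a = i \<star> (int p \<star> z) \<boxplus> k \<star> (m \<star> z)" by (simp add: pz mz)
      also have "\<dots> = (int p * i + m * k) \<star> z" using zB by (simp only: smul_smul smul_add_left)
      finally show ?thesis by blast
    qed
    have freez: "k = 0" if k: "k \<star> z = \<zero>\<^sub>B" for k
    proof -
      have "k \<star> y = int p \<star> (k \<star> z)" unfolding pz[symmetric] using zB by (simp add: smul_smul mult.commute)
      then show ?thesis using free k by simp
    qed
    have z: "z \<in> bsoc B" using odd_root_soc[OF K zK gen freez p(2) powJ] .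
    have "K \<subseteq> bsoc B" using gen soc_add(5)[OF z] by blast
    then show ?thesis unfolding soc_step_zero[OF K'(1)] using zK gen freez by blast
  next
    case True
    then obtain t where t: "m = int p * t" by blast
    \<comment> \<open>Subtracting ty from x keeps the coset modulo J and makes p times the element
      zero.\<close>
    define x' where "x' = x \<boxplus> \<boxminus> (t \<star> y)"
    have tyJ: "t \<star> y \<in> J" using J'(5)[OF y] .
    have tyK: "t \<star> y \<in> K" using tyJ JK by blast
    have x'K: "x' \<in> K" using K'(3,4) x(1) tyK by (simp add: x'_def)
    note x'B = KB[OF x'K]
    have x'J: "x' \<notin> J"
    proof
      assume "x' \<in> J"
      then have "x' \<boxplus> t \<star> y \<in> J" using J'(3) tyJ by blast
      moreover have "x' \<boxplus> t \<star> y = x" using xB yB by (simp add: x'_def add_assoc)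
      ultimately show False using x(2) by simp
    qed
    have px': "int p \<star> x' = \<zero>\<^sub>B"
    proof -
      have "int p \<star> x' = int p \<star> x \<boxplus> int p \<star> (\<boxminus> (t \<star> y))"
        unfolding x'_def by (rule smul_add_right[OF comm[OF x(1) K'(4)[OF tyK]] xB]) (use yB in simp)
      also have "int p \<star> (\<boxminus> (t \<star> y)) = \<boxminus> (m \<star> y)"
        using yB by (simp add: smul_neg_left[symmetric] smul_smul t mult.commute)
      finally show ?thesis using yB by (simp add: m)
    qed
    define L where "L = {a \<in> K. int p \<star> a = \<zero>\<^sub>B}"
    have LK: "L \<subseteq> K" by (auto simp: L_def)
    have LB: "l \<in> bcar B" if "l \<in> L" for l using that LK KB by blast
    have Lsub: "subgroup L (addG B)"
    proof (rule subgroup_addI)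
      show "L \<subseteq> bcar B" using LB by blast
      show "\<zero>\<^sub>B \<in> L" using K'(2) by (simp add: L_def)
      fix a assume a: "a \<in> L"
      then show "\<boxminus> a \<in> L" using K'(4) LB[OF a] smul_smul[of a "int p" "-1"] smul_smul[of a "-1" "int p"]
        by (simp add: L_def smul_neg_left)
      fix b assume b: "b \<in> L"
      show "a \<boxplus> b \<in> L"
        using a b K'(3) smul_add_right[OF comm LB LB, of a b] LK by (auto simp: L_def)
    qed
    have lamL: "\<lambda>\<^sub>B b l \<in> L" if "b \<in> bcar B" "l \<in> L" for b l
      using that K'(6) LB by (simp add: L_def lam_smul[symmetric])
    have conjL: "b \<boxplus> l \<boxplus> \<boxminus> b \<in> L" if b: "b \<in> bcar B" and l: "l \<in> L" for b l
    proof -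
      have "int p \<star> (b \<boxplus> l \<boxplus> \<boxminus> b) = b \<boxplus> int p \<star> l \<boxplus> \<boxminus> b"
        using hom_int_pow[OF conj_hom[OF b], of l "int p"] A.group_axioms LB[OF l] by simp
      then show ?thesis using K'(7)[OF b] l b by (simp add: L_def)
    qed
    have LJ: "a = \<zero>\<^sub>B" if aL: "a \<in> L" and aJ: "a \<in> J" for a
    proof -
      obtain k where k: "a = k \<star> y" using genJ[OF aJ] by blast
      then have "(int p * k) \<star> y = \<zero>\<^sub>B" using aL yB by (simp add: L_def smul_smul mult.commute)
      then have "k = 0" using free[of "int p * k"] p0 by simp
      then show ?thesis using k by simp
    qed
    have x'L: "k \<star> x' \<in> L" for k
    proof -
      have "x' \<in> L" using x'K px' by (simp add: L_def)
      then show ?thesis using subgroup_addD(5)[OF Lsub] by blast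
    qed
    have dec: "\<exists>j\<in>J. \<exists>l\<in>L. a = j \<boxplus> l" if a: "a \<in> K" for a
      using decomp[OF a x'K x'J] J'(5)[OF y] x'L by blast
    \<comment> \<open>L meets J trivially and together with J covers K, so the coset map from L to
      K/J is a bijection.\<close>
    have cL: "card L = p"
    proof -
      let ?c = "\<lambda>a. J #>\<^bsub>addG B\<^esub> a"
      note in_coset = mem_coset_iff[OF J'(1)]
      have "inj_on ?c L"
      proof (rule inj_onI)
        fix a b assume ab: "a \<in> L" "b \<in> L" "?c a = ?c b"
        have "a \<in> ?c a" using in_coset[of a a] LB[OF ab(1)] J'(2) by simp
        then have "a \<boxplus> \<boxminus> b \<in> J" using ab in_coset LB by simp
        moreover have "a \<boxplus> \<boxminus> b \<in> L" using subgroup_addD(3,4)[OF Lsub] ab by blast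
        ultimately show "a = b" using LJ diff_eq_zero_iff LB ab by blast
      qed
      moreover have "?c ` L = subquot B K J"
      proof
        show "?c ` L \<subseteq> subquot B K J" using LK by (auto simp: subquot_def)
        show "subquot B K J \<subseteq> ?c ` L"
        proof
          fix S assume "S \<in> subquot B K J"
          then obtain a where a: "a \<in> K" "S = ?c a" by (auto simp: subquot_def)
          obtain j l where jl: "j \<in> J" "l \<in> L" "a = j \<boxplus> l" using dec[OF a(1)] by blast
          have "a \<in> ?c l" using jl by (auto simp: r_coset_def)
          then have "?c a = ?c l"
            using A.repr_independence[of a J l] is_idealD(1)[OF J] LB[OF jl(2)] by simp
          then show "S \<in> ?c ` L" using a jl by blast
        qed
      qed
      ultimately show ?thesis using p(3) card_image by metis
    qed
    have Lm: "subgroup L (mulG B)" using left_ideal_subgroup_mulG[OF Lsub lamL] .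
    have Lpow: "l \<up> p = \<zero>\<^sub>B" if "l \<in> L" for l
      using M.pow_card_subgroup[OF Lm that] by (simp add: cL)
    have two: "y \<boxplus> y \<noteq> \<zero>\<^sub>B" using free[of 2] smul_two[OF yB] by auto
    \<comment> \<open>The p-th power of an element of L is zero for the multiplication, so the sign
      -1 is excluded again.\<close>
    have lam_y: "\<lambda>\<^sub>B l y = y" if l: "l \<in> L" for l
    proof (rule lam_odd_power[OF LB[OF l] yB _ p(2) _ two])
      show "\<lambda>\<^sub>B l y = y \<or> \<lambda>\<^sub>B l y = \<boxminus> y"
        by (rule lam_cyclic_unit[OF yB free _ LB[OF l]]) (use genJ idealD(1)[OF J _ y] in blast)+
      show "\<lambda>\<^sub>B (l \<up> p) y = y" using Lpow[OF l] yB by simp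
    qed
    have mul_comm: "l \<boxdot> j = j \<boxdot> l" if j: "j \<in> J" and l: "l \<in> L" for j l
    proof -
      have "\<lambda>\<^sub>B l j = j" using genJ[OF j] lam_y[OF l] LB[OF l] yB by (auto simp: lam_smul)
      then show ?thesis
        using mul_eq[OF LB[OF l] Jsoc(1)[OF j]] Jsoc(3,4)[OF j LB[OF l]] by simp
    qed
    have powj: "j \<up> n = int n \<star> j" if j: "j \<in> J" for j n
    proof (induction n)
      case (Suc n)
      have "j \<up> Suc n = int n \<star> j \<boxplus> j" using Suc Jsoc(4)[OF J'(5)[OF j] Jsoc(1)[OF j]] by simp
      also have "\<dots> = int (Suc n) \<star> j"
        using smul_add_left[of j "int n" 1] Jsoc(1)[OF j] by (simp add: add.commute)
      finally show ?case .
    qed simp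
    \<comment> \<open>The conjugate is a product of commuting elements j of J and l' of L. Its p-th
      power and that of l' vanish, so pj = 0, which puts j into the trivial intersection of L and
      J.\<close>
    have mconjL: "b \<boxdot> l \<boxdot> minv b \<in> L" if b: "b \<in> bcar B" and l: "l \<in> L" for b l
    proof -
      have lK: "l \<in> K" using l LK by blast
      obtain j l' where jl: "j \<in> J" "l' \<in> L" "b \<boxdot> l \<boxdot> minv b = j \<boxplus> l'"
        using dec[OF K'(8)[OF b lK]] by blast
      note jB = Jsoc(1)[OF jl(1)] and l'B = LB[OF jl(2)]
      have c: "b \<boxdot> l \<boxdot> minv b = j \<boxdot> l'" using jl(3) Jsoc(4)[OF jl(1) l'B] by simp
      have "(j \<boxdot> l') \<up> p = j \<up> p \<boxdot> l' \<up> p"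
        using M.pow_mult_distrib[of j l' p] mul_comm[OF jl(1,2)] jB l'B by simp
      moreover have "(b \<boxdot> l \<boxdot> minv b) \<up> p = b \<boxdot> (l \<up> p) \<boxdot> minv b"
        using hom_nat_pow[OF mconj_hom[OF b], of l p] M.group_axioms LB[OF l] by simp
      ultimately have "j \<up> p = \<zero>\<^sub>B" using c Lpow[OF l] Lpow[OF jl(2)] b jB by simp
      then have "j \<in> L" using powj[OF jl(1)] jl(1) JK by (auto simp: L_def)
      then have "j = \<zero>\<^sub>B" using LJ jl(1) by blast
      then show ?thesis using jl l'B by simp
    qed
    have L: "is_ideal B L" using idealI[OF Lsub lamL conjL mconjL] .
    note L' = ideal_add[OF L] idealD[OF L]
    \<comment> \<open>With d in L and lb = bd, comparing sums gives \<lambda>_l(b) - b = -l + (b +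
      \<lambda>_b(d) - b), and both summands on the right lie in L.\<close>
    have lamL': "\<lambda>\<^sub>B l b \<boxplus> \<boxminus> b \<in> L" if l: "l \<in> L" and b: "b \<in> bcar B" for l b
    proof -
      note lB = LB[OF l]
      define d where "d = minv b \<boxdot> l \<boxdot> b"
      have d: "d \<in> L" using L'(8)[OF minv_closed[OF b] l] b by (simp add: d_def)
      have "l \<boxdot> b = b \<boxdot> d" using b lB by (simp add: d_def mul_assoc)
      then have "l \<boxplus> \<lambda>\<^sub>B l b = b \<boxplus> \<lambda>\<^sub>B b d" using mul_eq b lB LB[OF d] by simp
      then have "\<boxminus> l \<boxplus> (l \<boxplus> \<lambda>\<^sub>B l b) \<boxplus> \<boxminus> b = \<boxminus> l \<boxplus> (b \<boxplus> \<lambda>\<^sub>B b d \<boxplus> \<boxminus> b)"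
        using b lB LB[OF d] by (simp add: add_assoc)
      then show ?thesis using L'(3)[OF L'(4)[OF l] L'(7)[OF b L'(6)[OF b d]]] b lB by simp
    qed
    have "soc_step B L K"
      unfolding soc_step_def
    proof (intro conjI ballI bexI[of _ y] allI impI)
      show "y \<in> K" using y JK by blast
      fix a assume a: "a \<in> K"
      obtain j l where jl: "j \<in> J" "l \<in> L" "a = j \<boxplus> l" using dec[OF a] by blast
      note jB = Jsoc(1)[OF jl(1)] and lB = LB[OF jl(2)]
      obtain k where k: "j = k \<star> y" using genJ[OF jl(1)] by blast
      have "a \<boxplus> \<boxminus> (k \<star> y) = l"
        using Jsoc(3)[OF jl(1) lB] jB lB by (simp add: jl(3) k[symmetric] add_assoc)
      then show "\<exists>k. a \<boxplus> \<boxminus> (k \<star> y) \<in> L" using jl(2) by metis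
      fix b assume b: "b \<in> bcar B"
      \<comment> \<open>The component j of a is in the socle, so it drops out of \<lambda> here and
        out of the additive commutator below.\<close>
      have "\<lambda>\<^sub>B a b = \<lambda>\<^sub>B l b"
        using Jsoc(4)[OF jl(1) lB] lam_mul[OF jB lB b] Jsoc(2)[OF jl(1) lam_closed[OF lB b]] jl(3) by simp
      then show "\<lambda>\<^sub>B a b \<boxplus> \<boxminus> b \<in> L" using lamL'[OF jl(2) b] by simp
      have "a \<boxplus> b \<boxplus> \<boxminus> (b \<boxplus> a) = j \<boxplus> (l \<boxplus> b \<boxplus> \<boxminus> l) \<boxplus> \<boxminus> j \<boxplus> \<boxminus> b"
        using b jB lB by (simp add: jl(3) neg_sum add_assoc)
      also have "j \<boxplus> (l \<boxplus> b \<boxplus> \<boxminus> l) = (l \<boxplus> b \<boxplus> \<boxminus> l) \<boxplus> j"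
        using Jsoc(3)[OF jl(1), of "l \<boxplus> b \<boxplus> \<boxminus> l"] b lB by simp
      also have "\<dots> \<boxplus> \<boxminus> j \<boxplus> \<boxminus> b = l \<boxplus> (b \<boxplus> \<boxminus> l \<boxplus> \<boxminus> b)"
        using b jB lB by (simp add: add_assoc)
      finally show "a \<boxplus> b \<boxplus> \<boxminus> (b \<boxplus> a) \<in> L" using L'(3)[OF jl(2) L'(7)[OF b L'(4)[OF jl(2)]]] by simp
    next
      fix k assume "k \<star> y \<in> L"
      then have "k \<star> y = \<zero>\<^sub>B" using LJ J'(5)[OF y] by blast
      then show "k = 0" using free by simp
    qed
    then show ?thesis using L LK cL by blast
  qed
qed

end

section \<open>Sorting a chain of ideals\<close>

text \<open>Ideals and inclusion are part of the step, so a chain of ideals becomes a path for a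
  binary relation.\<close>

definition prime_step :: "('a, 'b) brace_scheme \<Rightarrow> nat \<Rightarrow> 'a set \<Rightarrow> 'a set \<Rightarrow> bool" where
  "prime_step B p I J \<longleftrightarrow> is_ideal B I \<and> is_ideal B J \<and> I \<subseteq> J \<and>
     Factorial_Ring.prime p \<and> card (subquot B J I) = p"

definition cyclic_step :: "('a, 'b) brace_scheme \<Rightarrow> 'a set \<Rightarrow> 'a set \<Rightarrow> bool" where
  "cyclic_step B I J \<longleftrightarrow> is_ideal B I \<and> is_ideal B J \<and> I \<subseteq> J \<and> soc_cyclic_step B I J"

section \<open>The exchanges over an arbitrary lower ideal\<close>

context skew_brace
begin

lemma cyclic_step_iff:
  "cyclic_step B I J \<longleftrightarrow> is_ideal B I \<and> is_ideal B J \<and> I \<subseteq> J \<and> soc_step B I J"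
  using soc_cyclic_step_iff by (auto simp: cyclic_step_def)

lemma prime_step_swap:
  assumes IJ: "prime_step B p I J" and JK: "prime_step B q J K" and "p < q"
  shows "\<exists>L. prime_step B q I L \<and> prime_step B p L K"
proof -
  have I: "is_ideal B I" and J: "is_ideal B J" and K: "is_ideal B K" and sub: "I \<subseteq> J" "J \<subseteq> K"
    and p: "Factorial_Ring.prime p" "card (subquot B J I) = p"
    and q: "Factorial_Ring.prime q" "card (subquot B K J) = q"
    using IJ JK by (auto simp: prime_step_def)
  let ?Q = "bquot B I" and ?h = "\<lambda>a. I #>\<^bsub>addG B\<^esub> a"
  interpret H: brace_hom B ?Q ?h using bquot_hom[OF I] .
  have ker: "H.pre {bzero ?Q} = I" using bquot_kernel[OF I] .
  \<comment> \<open>J and K contain I, so nothing is lost by passing to the quotient, where the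
    lower factor is itself an ideal, and taking preimages afterwards.\<close>
  have preJ: "H.pre (?h ` J) = J" and preK: "H.pre (?h ` K) = K"
    using H.pre_image ker J K sub by auto
  have hJ: "is_ideal ?Q (?h ` J)" and hK: "is_ideal ?Q (?h ` K)" using H.ideal_image J K by auto
  have zQ: "{bzero ?Q} \<subseteq> bcar ?Q" by simp
  have "\<exists>L. is_ideal ?Q L \<and> L \<subseteq> ?h ` K \<and> card L = q \<and> card (subquot ?Q (?h ` K) L) = p"
  proof (rule H.C.swap_primes[OF hJ hK _ p(1) _ q(1) _ \<open>p < q\<close>])
    show "?h ` J \<subseteq> ?h ` K" using sub by blast
    show "card (?h ` J) = p" using p(2) by (simp add: subquot_def)
    show "card (subquot ?Q (?h ` K) (?h ` J)) = q"
      using H.card_subquot_pre[OF is_idealD(5)[OF hJ] is_idealD(5)[OF hK]] q(2) by (simp add: preJ preK)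
  qed
  then obtain L where L: "is_ideal ?Q L" "L \<subseteq> ?h ` K" "card L = q" "card (subquot ?Q (?h ` K) L) = p"
    by blast
  have "{bzero ?Q} \<subseteq> L" using H.C.ideal_add(2)[OF L(1)] by simp
  then have "I \<subseteq> H.pre L" "H.pre L \<subseteq> K" using H.pre_mono ker preK L(2) by blast+
  moreover have "card (subquot B (H.pre L) I) = q"
    using H.card_subquot_pre[OF zQ is_idealD(5)[OF L(1)]] H.C.card_subquot_zero[OF is_idealD(5)[OF L(1)]] L(3)
    by (simp add: ker)
  moreover have "card (subquot B K (H.pre L)) = p"
    using H.card_subquot_pre[OF is_idealD(5)[OF L(1)] is_idealD(5)[OF hK]] L(4) by (simp add: preK)
  ultimately show ?thesis
    using H.ideal_pre[OF L(1)] I K p(1) q(1) by (auto simp: prime_step_def)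
qed

lemma cyclic_odd_step_swap:
  assumes IJ: "cyclic_step B I J" and JK: "prime_step B p J K" and "odd p"
  shows "cyclic_step B I K \<or> (\<exists>L. prime_step B p I L \<and> cyclic_step B L K)"
proof -
  have I: "is_ideal B I" and J: "is_ideal B J" and K: "is_ideal B K" and sub: "I \<subseteq> J" "J \<subseteq> K"
    and s: "soc_step B I J"
    and p: "Factorial_Ring.prime p" "card (subquot B K J) = p"
    using IJ JK by (auto simp: prime_step_def cyclic_step_iff)
  let ?Q = "bquot B I" and ?h = "\<lambda>a. I #>\<^bsub>addG B\<^esub> a"
  interpret H: brace_hom B ?Q ?h using bquot_hom[OF I] .
  have ker: "H.pre {bzero ?Q} = I" using bquot_kernel[OF I] .
  have preJ: "H.pre (?h ` J) = J" and preK: "H.pre (?h ` K) = K"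
    using H.pre_image ker J K sub by auto
  have hJ: "is_ideal ?Q (?h ` J)" and hK: "is_ideal ?Q (?h ` K)" using H.ideal_image J K by auto
  have zQ: "{bzero ?Q} \<subseteq> bcar ?Q" by simp
  have "soc_step ?Q {bzero ?Q} (?h ` K) \<or>
    (\<exists>L. is_ideal ?Q L \<and> L \<subseteq> ?h ` K \<and> card L = p \<and> soc_step ?Q L (?h ` K))"
  proof (rule H.C.swap_soc_odd[OF hJ hK _ _ p(1) \<open>odd p\<close>])
    show "?h ` J \<subseteq> ?h ` K" using sub by blast
    show "soc_step ?Q {bzero ?Q} (?h ` J)"
      using H.soc_step_pre[OF zQ is_idealD(5)[OF hJ]] s by (simp add: ker preJ)
    show "card (subquot ?Q (?h ` K) (?h ` J)) = p"
      using H.card_subquot_pre[OF is_idealD(5)[OF hJ] is_idealD(5)[OF hK]] p(2) by (simp add: preJ preK)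
  qed
  then show ?thesis
  proof
    assume "soc_step ?Q {bzero ?Q} (?h ` K)"
    then have "soc_step B I K"
      using H.soc_step_pre[OF zQ is_idealD(5)[OF hK]] by (simp add: ker preK)
    then show ?thesis using I K sub by (auto simp: cyclic_step_iff)
  next
    assume "\<exists>L. is_ideal ?Q L \<and> L \<subseteq> ?h ` K \<and> card L = p \<and> soc_step ?Q L (?h ` K)"
    then obtain L where L: "is_ideal ?Q L" "L \<subseteq> ?h ` K" "card L = p" "soc_step ?Q L (?h ` K)" by blast
    have "{bzero ?Q} \<subseteq> L" using H.C.ideal_add(2)[OF L(1)] by simp
    then have "I \<subseteq> H.pre L" "H.pre L \<subseteq> K" using H.pre_mono ker preK L(2) by blast+
    moreover have "card (subquot B (H.pre L) I) = p"
      using H.card_subquot_pre[OF zQ is_idealD(5)[OF L(1)]] H.C.card_subquot_zero[OF is_idealD(5)[OF L(1)]] L(3)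
      by (simp add: ker)
    moreover have "soc_step B (H.pre L) K"
      using H.soc_step_pre[OF is_idealD(5)[OF L(1)] is_idealD(5)[OF hK]] L(4) by (simp add: preK)
    ultimately show ?thesis
      using H.ideal_pre[OF L(1)] I K p(1) by (auto simp: prime_step_def cyclic_step_iff)
  qed
qed

lemma two_cyclic_step_swap:
  assumes IJ: "prime_step B 2 I J" and JK: "cyclic_step B J K"
  shows "\<exists>L M. cyclic_step B I L \<and> prime_step B 2 L M \<and> prime_step B 2 M K"
proof -
  have I: "is_ideal B I" and J: "is_ideal B J" and K: "is_ideal B K" and sub: "I \<subseteq> J" "J \<subseteq> K"
    and s: "soc_step B J K" and c: "card (subquot B J I) = 2"
    using IJ JK by (auto simp: prime_step_def cyclic_step_iff)
  let ?Q = "bquot B I" and ?h = "\<lambda>a. I #>\<^bsub>addG B\<^esub> a"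
  interpret H: brace_hom B ?Q ?h using bquot_hom[OF I] .
  have ker: "H.pre {bzero ?Q} = I" using bquot_kernel[OF I] .
  have preJ: "H.pre (?h ` J) = J" and preK: "H.pre (?h ` K) = K"
    using H.pre_image ker J K sub by auto
  have hJ: "is_ideal ?Q (?h ` J)" and hK: "is_ideal ?Q (?h ` K)" using H.ideal_image J K by auto
  have zQ: "{bzero ?Q} \<subseteq> bcar ?Q" by simp
  have "\<exists>L M. is_ideal ?Q L \<and> is_ideal ?Q M \<and> L \<subseteq> M \<and> M \<subseteq> ?h ` K \<and> soc_step ?Q {bzero ?Q} L \<and>
    card (subquot ?Q M L) = 2 \<and> card (subquot ?Q (?h ` K) M) = 2"
  proof (rule H.C.swap_two_soc[OF hJ hK])
    show "?h ` J \<subseteq> ?h ` K" using sub by blast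
    show "card (?h ` J) = 2" using c by (simp add: subquot_def)
    show "soc_step ?Q (?h ` J) (?h ` K)"
      using H.soc_step_pre[OF is_idealD(5)[OF hJ] is_idealD(5)[OF hK]] s by (simp add: preJ preK)
  qed
  then obtain L M where L: "is_ideal ?Q L" and M: "is_ideal ?Q M" and LM: "L \<subseteq> M" "M \<subseteq> ?h ` K"
    and st: "soc_step ?Q {bzero ?Q} L" "card (subquot ?Q M L) = 2" "card (subquot ?Q (?h ` K) M) = 2"
    by blast
  have "{bzero ?Q} \<subseteq> L" using H.C.ideal_add(2)[OF L] by simp
  then have "I \<subseteq> H.pre L" "H.pre L \<subseteq> H.pre M" "H.pre M \<subseteq> K"
    using H.pre_mono ker preK LM by blast+
  moreover have "soc_step B I (H.pre L)"
    using H.soc_step_pre[OF zQ is_idealD(5)[OF L]] st(1) by (simp add: ker)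
  moreover have "card (subquot B (H.pre M) (H.pre L)) = 2"
    using H.card_subquot_pre[OF is_idealD(5)[OF L] is_idealD(5)[OF M]] st(2) by simp
  moreover have "card (subquot B K (H.pre M)) = 2"
    using H.card_subquot_pre[OF is_idealD(5)[OF M] is_idealD(5)[OF hK]] st(3) by (simp add: preK)
  ultimately have "cyclic_step B I (H.pre L)" "prime_step B 2 (H.pre L) (H.pre M)" "prime_step B 2 (H.pre M) K"
    using H.ideal_pre[OF L] H.ideal_pre[OF M] I K by (auto simp: prime_step_def cyclic_step_iff)
  then show ?thesis by blast
qed

end

text \<open>The number \<open>q\<close> is a lower bound for the primes occurring in the chain.\<close>

inductive odd_chain :: "('a, 'b) brace_scheme \<Rightarrow> nat \<Rightarrow> 'a set \<Rightarrow> bool" for B where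
  odd_chain_zero: "odd_chain B q {bzero B}"
| odd_chain_step: "odd_chain B p I \<Longrightarrow> prime_step B p I J \<Longrightarrow> odd p \<Longrightarrow> q \<le> p \<Longrightarrow> odd_chain B q J"

inductive soc_chain :: "('a, 'b) brace_scheme \<Rightarrow> 'a set \<Rightarrow> bool" for B where
  soc_chain_odd: "odd_chain B q I \<Longrightarrow> soc_chain B I"
| soc_chain_step: "soc_chain B I \<Longrightarrow> cyclic_step B I J \<Longrightarrow> soc_chain B J"

inductive two_chain :: "('a, 'b) brace_scheme \<Rightarrow> 'a set \<Rightarrow> bool" for B where
  two_chain_soc: "soc_chain B I \<Longrightarrow> two_chain B I"
| two_chain_step: "two_chain B I \<Longrightarrow> prime_step B 2 I J \<Longrightarrow> two_chain B J"

section \<open>Inserting one factor into a sorted chain\<close>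

context skew_brace
begin

text \<open>The factor that ends on top is either the new p or the old top prime, which is at least
  q; this explains the bound \<open>min p q\<close>.\<close>

lemma odd_chain_append:
  "odd_chain B q I \<Longrightarrow> prime_step B p I J \<Longrightarrow> odd p \<Longrightarrow> odd_chain B (min p q) J"
proof (induction arbitrary: p J rule: odd_chain.induct)
  case (odd_chain_zero q)
  show ?case
    by (rule odd_chain.odd_chain_step[OF odd_chain.odd_chain_zero odd_chain_zero min.cobounded1])
next
  case (odd_chain_step r I' I q)
  show ?case
  proof (cases "p \<le> r")
    case True
    then have "odd_chain B p I"
      using odd_chain.odd_chain_step[OF odd_chain_step.hyps(1-3)] by blast
    then show ?thesis
      using odd_chain.odd_chain_step[OF _ odd_chain_step.prems] by simp
  next
    case False
    then obtain L where L: "prime_step B p I' L" "prime_step B r L J"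
      using prime_step_swap[OF odd_chain_step.hyps(2) odd_chain_step.prems(1)] by auto
    \<comment> \<open>Since r < p, the bound is r itself, and the step of order r may be put back on
      top.\<close>
    have "odd_chain B (min p r) L" using odd_chain_step.IH[OF L(1) odd_chain_step.prems(2)] .
    then have "odd_chain B r L" using False by (simp add: min_def split: if_splits)
    then show ?thesis
      using odd_chain.odd_chain_step[OF _ L(2) odd_chain_step.hyps(3)] odd_chain_step.hyps(4) by simp
  qed
qed

text \<open>If the prime merges with the top cyclic factor, the enlarged cyclic step replaces it;
  otherwise the prime passes below and is inserted into the shorter chain.\<close>

lemma soc_chain_append_odd:
  "soc_chain B I \<Longrightarrow> prime_step B p I J \<Longrightarrow> odd p \<Longrightarrow> soc_chain B J"
proof (induction arbitrary: J rule: soc_chain.induct)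
  case (soc_chain_odd q I)
  then show ?case using odd_chain_append soc_chain.soc_chain_odd by blast
next
  case (soc_chain_step I' I)
  then show ?case
    using cyclic_odd_step_swap[of I' I p J] soc_chain.soc_chain_step by blast
qed

text \<open>An odd prime exceeds 2, so it passes every factor of order 2 by
  \<open>prime_step_swap\<close> until it reaches the part without such factors.\<close>

lemma two_chain_append_prime:
  "two_chain B I \<Longrightarrow> prime_step B p I J \<Longrightarrow> two_chain B J"
proof (induction arbitrary: J rule: two_chain.induct)
  case (two_chain_soc I)
  show ?case
  proof (cases "odd p")
    case True
    then show ?thesis using two_chain_soc soc_chain_append_odd two_chain.two_chain_soc by blast
  next
    case False
    then have "p = 2" using two_chain_soc by (metis prime_step_def primes_dvd_imp_eq two_is_prime_nat)
    then show ?thesis using two_chain_soc two_chain.intros by blast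
  qed
next
  case (two_chain_step I' I)
  show ?case
  proof (cases "p = 2")
    case True
    then show ?thesis using two_chain_step two_chain.two_chain_step by blast
  next
    case False
    then have "2 < p" using two_chain_step.prems prime_ge_2_nat[of p] by (simp add: prime_step_def)
    then show ?thesis
      using prime_step_swap[OF two_chain_step.hyps(2) two_chain_step.prems] two_chain_step.IH
        two_chain.two_chain_step by blast
  qed
qed

text \<open>Passing a factor of order 2 leaves two of them, but these are put back above the shorter
  chain obtained by induction, so the extra factor does not disturb termination.\<close>

lemma two_chain_append_cyclic:
  "two_chain B I \<Longrightarrow> cyclic_step B I J \<Longrightarrow> two_chain B J"
proof (induction arbitrary: J rule: two_chain.induct)
  case (two_chain_soc I)
  then show ?case using soc_chain.soc_chain_step two_chain.two_chain_soc by blast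
next
  case (two_chain_step I' I)
  then show ?case
    using two_cyclic_step_swap[of I' I J] two_chain.two_chain_step by blast
qed

lemma supersoluble_two_chain:
  assumes "supersoluble B"
  shows "two_chain B (bcar B)"
proof -
  obtain n :: nat and I where I: "I 0 = {\<zero>\<^sub>B}" "I n = bcar B" "\<And>i. i \<le> n \<Longrightarrow> is_ideal B (I i)"
    and step: "\<And>i. i < n \<Longrightarrow> I i \<subseteq> I (Suc i) \<and> (soc_cyclic_step B (I i) (I (Suc i)) \<or>
      Factorial_Ring.prime (card (subquot B (I (Suc i)) (I i))))"
    using assms unfolding supersoluble_def by blast
  have "i \<le> n \<Longrightarrow> two_chain B (I i)" for i
  proof (induction i)
    case 0
    show ?case using two_chain_soc[OF soc_chain_odd[OF odd_chain_zero]] by (simp add: I(1))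
  next
    case (Suc i)
    then have "cyclic_step B (I i) (I (Suc i)) \<or>
        prime_step B (card (subquot B (I (Suc i)) (I i))) (I i) (I (Suc i))"
      using step[of i] I(3) by (auto simp: cyclic_step_def prime_step_def)
    moreover have "two_chain B (I i)" using Suc by simp
    ultimately show ?case
      using two_chain_append_cyclic two_chain_append_prime by blast
  qed
  then show ?thesis using I(2) by force
qed

text \<open>The last conjunct is what the induction needs: it bounds the top prime from below and so
  yields the comparison with the next one. Writing the top index by \<open>Suc i = l\<close> makes
  it vacuous for length zero.\<close>

lemma odd_chain_sequence:
  "odd_chain B q J \<Longrightarrow> \<exists>(l::nat) f. f 0 = {\<zero>\<^sub>B} \<and> f l = J \<and> (\<forall>i\<le>l. is_ideal B (f i)) \<and>
    (\<forall>i<l. f i \<subseteq> f (Suc i)) \<and>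
    (\<forall>i<l. Factorial_Ring.prime (card (subquot B (f (Suc i)) (f i))) \<and> odd (card (subquot B (f (Suc i)) (f i)))) \<and>
    (\<forall>i. i + 1 < l \<longrightarrow>
      card (subquot B (f (Suc (Suc i))) (f (Suc i))) \<le> card (subquot B (f (Suc i)) (f i))) \<and>
    (\<forall>i. Suc i = l \<longrightarrow> q \<le> card (subquot B (f (Suc i)) (f i)))"
proof (induction rule: odd_chain.induct)
  case (odd_chain_zero q)
  show ?case
    by (rule exI[of _ 0], rule exI[of _ "\<lambda>_. {\<zero>\<^sub>B}"]) (intro conjI allI impI; simp add: zero_ideal)
next
  case (odd_chain_step p I J q)
  then obtain l :: nat and f where f: "f 0 = {\<zero>\<^sub>B}" "f l = I" "\<forall>i\<le>l. is_ideal B (f i)"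
    "\<forall>i<l. f i \<subseteq> f (Suc i)"
    "\<forall>i<l. Factorial_Ring.prime (card (subquot B (f (Suc i)) (f i))) \<and> odd (card (subquot B (f (Suc i)) (f i)))"
    "\<forall>i. i + 1 < l \<longrightarrow>
      card (subquot B (f (Suc (Suc i))) (f (Suc i))) \<le> card (subquot B (f (Suc i)) (f i))"
    "\<forall>i. Suc i = l \<longrightarrow> p \<le> card (subquot B (f (Suc i)) (f i))" by blast
  have J: "is_ideal B J" "I \<subseteq> J" "Factorial_Ring.prime p" "card (subquot B J I) = p" "odd p" "q \<le> p"
    using odd_chain_step.hyps by (auto simp: prime_step_def)
  define g where "g i = (if i \<le> l then f i else J)" for i
  have g: "g i = f i" if "i \<le> l" for i using that by (simp add: g_def)
  have gS: "g (Suc l) = J" by (simp add: g_def)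
  show ?case
  proof (rule exI[of _ "Suc l"], rule exI[of _ g], intro conjI allI impI)
    show "g 0 = {\<zero>\<^sub>B}" "g (Suc l) = J" using f(1) g gS by simp_all
    show "is_ideal B (g i)" if "i \<le> Suc l" for i
      using f(3) J(1) by (simp add: g_def)
    show "g i \<subseteq> g (Suc i)" if "i < Suc l" for i
      using that f(2,4) J(2) g gS by (cases "i = l") auto
    show "Factorial_Ring.prime (card (subquot B (g (Suc i)) (g i)))"
      and "odd (card (subquot B (g (Suc i)) (g i)))" if "i < Suc l" for i
      using that f(2,5) J(3-5) g gS by (cases "i = l"; simp)+
    show "card (subquot B (g (Suc (Suc i))) (g (Suc i))) \<le> card (subquot B (g (Suc i)) (g i))"
      if "i + 1 < Suc l" for i
      using that f(2,6,7) J(4) g gS by (cases "Suc i = l") auto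
    show "q \<le> card (subquot B (g (Suc i)) (g i))" if "Suc i = Suc l" for i
      using that f(2) J(4,6) g gS by simp
  qed
qed

lemma soc_chain_rtranclp:
  "soc_chain B J \<Longrightarrow> \<exists>q I. odd_chain B q I \<and> (cyclic_step B)\<^sup>*\<^sup>* I J"
  by (induction rule: soc_chain.induct) (blast intro: rtranclp.intros)+

lemma two_chain_rtranclp:
  "two_chain B J \<Longrightarrow> \<exists>I. soc_chain B I \<and> (prime_step B 2)\<^sup>*\<^sup>* I J"
  by (induction rule: two_chain.induct) (blast intro: rtranclp.intros)+

end

lemma rtranclp_sequence:
  assumes "R\<^sup>*\<^sup>* x y"
  obtains n :: nat and f where "f 0 = x" "f n = y" "\<And>i. i < n \<Longrightarrow> R (f i) (f (Suc i))"
  using rtranclp_imp_relpowp[OF assms] unfolding relpowp_fun_conv by blast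

theorem theorem3p11:
  fixes B :: "('a, 'b) brace_scheme"
  assumes "is_brace B" and "supersoluble B"
  shows "\<exists>(l::nat) (m::nat) (n::nat) (I0 :: nat \<Rightarrow> 'a set) I1 I2.
     I0 0 = {bzero B} \<and> I0 l = I1 0 \<and> I1 m = I2 0 \<and> I2 n = bcar B \<and>
     (\<forall>i\<le>l. is_ideal B (I0 i)) \<and> (\<forall>i\<le>m. is_ideal B (I1 i)) \<and> (\<forall>i\<le>n. is_ideal B (I2 i)) \<and>
     (\<forall>i<l. I0 i \<subseteq> I0 (Suc i)) \<and> (\<forall>i<m. I1 i \<subseteq> I1 (Suc i)) \<and> (\<forall>i<n. I2 i \<subseteq> I2 (Suc i)) \<and>
     (\<forall>i<l. Factorial_Ring.prime (card (subquot B (I0 (Suc i)) (I0 i))) \<and> odd (card (subquot B (I0 (Suc i)) (I0 i)))) \<and>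
     (\<forall>i. i + 1 < l \<longrightarrow>
        card (subquot B (I0 (Suc (Suc i))) (I0 (Suc i))) \<le> card (subquot B (I0 (Suc i)) (I0 i))) \<and>
     (\<forall>i<m. soc_cyclic_step B (I1 i) (I1 (Suc i))) \<and>
     (\<forall>i<n. card (subquot B (I2 (Suc i)) (I2 i)) = 2)"
proof -
  interpret skew_brace B using assms(1) by (rule skew_brace.intro)
  obtain T where T: "soc_chain B T" "(prime_step B 2)\<^sup>*\<^sup>* T (bcar B)"
    using two_chain_rtranclp[OF supersoluble_two_chain[OF assms(2)]] by blast
  obtain q S where S: "odd_chain B q S" "(cyclic_step B)\<^sup>*\<^sup>* S T"
    using soc_chain_rtranclp[OF T(1)] by blast
  obtain l I0 where I0: "I0 0 = {bzero B}" "I0 l = S" "\<forall>i\<le>l. is_ideal B (I0 i)"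
    "\<forall>i<l. I0 i \<subseteq> I0 (Suc i)"
    "\<forall>i<l. Factorial_Ring.prime (card (subquot B (I0 (Suc i)) (I0 i))) \<and> odd (card (subquot B (I0 (Suc i)) (I0 i)))"
    "\<forall>i. i + 1 < l \<longrightarrow>
      card (subquot B (I0 (Suc (Suc i))) (I0 (Suc i))) \<le> card (subquot B (I0 (Suc i)) (I0 i))"
    using odd_chain_sequence[OF S(1)] by blast
  obtain m I1 where I1: "I1 0 = S" "I1 m = T" "\<And>i. i < m \<Longrightarrow> cyclic_step B (I1 i) (I1 (Suc i))"
    using rtranclp_sequence[OF S(2)] by blast
  obtain n I2 where I2: "I2 0 = T" "I2 n = bcar B" "\<And>i. i < n \<Longrightarrow> prime_step B 2 (I2 i) (I2 (Suc i))"
    using rtranclp_sequence[OF T(2)] by blast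
  \<comment> \<open>A cyclic or prime step gives ideals only at its ends, so the start of a segment,
    which may have length zero, gets its ideal property from the end of the segment before.\<close>
  have idS: "is_ideal B S" using I0(2,3) by blast
  have id1: "is_ideal B (I1 i)" if "i \<le> m" for i
    using that idS I1(1) I1(3)[of "i - 1"] by (cases i) (auto simp: cyclic_step_def)
  have idT: "is_ideal B T" using id1[of m] I1(2) by simp
  have id2: "is_ideal B (I2 i)" if "i \<le> n" for i
    using that idT I2(1) I2(3)[of "i - 1"] by (cases i) (auto simp: prime_step_def)
  show ?thesis
    by (rule exI[of _ l], rule exI[of _ m], rule exI[of _ n], rule exI[of _ I0],
        rule exI[of _ I1], rule exI[of _ I2])
       (use I0 I1 I2 id1 id2 in \<open>auto simp: cyclic_step_def prime_step_def\<close>)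
qed

end
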